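(* Let $F_{\mathrm{sym}}:\mathbb{R}^{d\times r}\to\mathcal{S}^d$, $F_{\mathrm{sym}}(X)=XX^\top$. Then $\|\nabla F_{\mathrm{sym}}(X)-\nabla F_{\mathrm{sym}}(Y)\|_{\mathrm{op}}\le2\|X-Y\|_F$ for all $X,Y\in\mathbb{R}^{d\times r}$. Moreover, for any positive semidefinite $Z^\star\in\mathcal{S}^d$ with $\operatorname{rank}(Z^\star)=r^\star$, $1\le r^\star\le r$, the map $F_{\mathrm{sym}}$ is weakly aligned at $Z^\star$ with the functions $$s(\rho)=\frac{4\rho}{\sqrt{2(r-r^\star+1)}}\quad\text{and}\quad\delta(\rho)=\min\left\{\frac{\rho}{\sqrt2},\frac{1}{1+s(\rho)},\frac13\right\}\lambda_{r^\star}(Z^\star).$$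
   Context: $\mathcal{S}^d$ is the space of symmetric $d\times d$ real matrices; all matrix spaces carry the trace inner product and Frobenius norm $\|\cdot\|_F$. $\lambda_i(Z)$ is the $i$-th largest eigenvalue. For a $C^1$ map $F$ between Euclidean spaces, $\nabla F(x)$ is the derivative; fix for each $x$ an SVD of $\nabla F(x)$ with singular values $\sigma_1^x\ge\sigma_2^x\ge\cdots$, and let $\Pi_j^x$ be the orthogonal projection onto the span of its top $j$ left singular vectors. $B_r(z)$ is the closed ball, $\mathbb{R}_+$ the positive reals. $F$ is weakly aligned at $z^\star\in\operatorname{Im}F$ with functions $\delta,s:\mathbb{R}_+\to\mathbb{R}_+$ if for any $\rho>0$ and any $z=F(x)\in B_{\delta(\rho)}(z^\star)$ there is an index $j$ such that $\|(I-\Pi^x_j)(z-z^\star)\|\le\rho\|z-z^\star\|$ and $(\sigma^x_j)^2\ge s(\rho)\|z-z^\star\|$. *)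

theory Defs
  imports "HOL-Analysis.Analysis" "HOL-Computational_Algebra.Polynomial"
begin

text \<open>
  A \<open>d \<times> r\<close> real matrix is an element of \<^typ>\<open>real^'r^'d\<close>. On this type the library's
  \<open>norm\<close> is the Frobenius norm and the library's inner product is the trace inner product
  (both are computed entrywise), and \<open>dist\<close>, \<open>cball\<close> and \<open>onorm\<close> refer to that norm.
\<close>

definition sym_mats :: "(real^'d^'d) set" where
  "sym_mats = {Z. transpose Z = Z}"

definition psd :: "real^'d^'d \<Rightarrow> bool" where
  "psd Z \<longleftrightarrow> Z \<in> sym_mats \<and> (\<forall>x. 0 \<le> x \<bullet> (Z *v x))"

definition char_polynomial :: "real^'d^'d \<Rightarrow> real poly" where
  "char_polynomial Z = det (\<chi> i j. (if i = j then [:0, 1:] else 0) - [:Z $ i $ j:])"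

text \<open>
  The \<open>i\<close>-th largest eigenvalue, counted with multiplicity, for \<open>1 \<le> i \<le> CARD('d)\<close>.
  Meaningful only for matrices all of whose eigenvalues are real, such as symmetric ones.
\<close>

definition nth_eigenvalue :: "real^'d^'d \<Rightarrow> nat \<Rightarrow> real" where
  "nth_eigenvalue Z i = rev (sorted_list_of_multiset (proots (char_polynomial Z))) ! (i - 1)"

definition orth_proj :: "'b::euclidean_space set \<Rightarrow> 'b \<Rightarrow> 'b" where
  "orth_proj S z = (THE p. p \<in> S \<and> (\<forall>w\<in>S. orthogonal (z - p) w))"

lemma orth_proj_props:
  fixes S :: "'b::euclidean_space set"
  assumes "subspace S"
  shows "orth_proj S z \<in> S \<and> (\<forall>w\<in>S. orthogonal (z - orth_proj S z) w)"
proof -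
  have span: "span S = S"
    using assms by (simp add: span_eq_iff)
  obtain p q where "p \<in> span S" "\<And>w. w \<in> span S \<Longrightarrow> orthogonal q w" "z = p + q"
    by (rule orthogonal_subspace_decomp_exists[of S z]) blast
  then have pq: "p \<in> S" "\<And>w. w \<in> S \<Longrightarrow> orthogonal q w" "z = p + q"
    unfolding span by blast+
  have "\<exists>!p. p \<in> S \<and> (\<forall>w\<in>S. orthogonal (z - p) w)"
  proof (rule ex1I[of _ p])
    show "p \<in> S \<and> (\<forall>w\<in>S. orthogonal (z - p) w)"
      using pq(1,2) unfolding pq(3) by (simp only: add_diff_cancel_left') blast
  next
    fix p' assume p': "p' \<in> S \<and> (\<forall>w\<in>S. orthogonal (z - p') w)"
    then have d: "p - p' \<in> S"
      using pq(1) assms by (simp add: subspace_diff)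
    have a: "(z - p') \<bullet> (p - p') = 0"
      using p' d unfolding orthogonal_def by blast
    have "q \<bullet> (p - p') = 0"
      using pq(2)[OF d] unfolding orthogonal_def .
    moreover have "z - p' = (p - p') + q"
      unfolding pq(3) by (simp only: diff_add_eq)
    ultimately have "(p - p') \<bullet> (p - p') = 0"
      using a by (simp only: inner_add_left add_0_right)
    then have "p - p' = 0"
      by (simp only: inner_eq_zero_iff)
    then show "p' = p" by (simp only: right_minus_eq)
  qed
  from theI'[OF this] show ?thesis
    unfolding orth_proj_def .
qed

text \<open>
  Singular value decompositions of a linear map from a Euclidean space \<open>'a\<close> into a Euclidean space
  that is given as a subspace \<open>W\<close> of \<open>'b\<close>; in particular the left singular vectors lie in \<open>W\<close>.
  Indices run over \<open>1, \<dots>, min (dim 'a) (dim W)\<close>; singular values may be zero.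
\<close>

definition is_svd ::
  "'b::euclidean_space set \<Rightarrow> ('a::euclidean_space \<Rightarrow> 'b) \<Rightarrow>
    (nat \<Rightarrow> real) \<Rightarrow> (nat \<Rightarrow> 'b) \<Rightarrow> (nat \<Rightarrow> 'a) \<Rightarrow> bool" where
  "is_svd W A \<sigma> u v \<longleftrightarrow>
     (let I = {1..min DIM('a) (dim W)} in
       (\<forall>i\<in>I. 0 \<le> \<sigma> i) \<and>
       (\<forall>i\<in>I. \<forall>j\<in>I. i \<le> j \<longrightarrow> \<sigma> j \<le> \<sigma> i) \<and>
       (\<forall>i\<in>I. u i \<in> W) \<and>
       (\<forall>i\<in>I. \<forall>j\<in>I. u i \<bullet> u j = (if i = j then 1 else 0)) \<and>
       (\<forall>i\<in>I. \<forall>j\<in>I. v i \<bullet> v j = (if i = j then 1 else 0)) \<and>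
       (\<forall>h. A h = (\<Sum>i\<in>I. (\<sigma> i * (v i \<bullet> h)) *\<^sub>R u i)))"

abbreviation deriv_at ::
  "('a::euclidean_space \<Rightarrow> 'b::euclidean_space) \<Rightarrow> 'a \<Rightarrow> 'a \<Rightarrow> 'b" where
  "deriv_at F x \<equiv> frechet_derivative F (at x)"

text \<open>
  Weak alignment of a \<open>C\<^sup>1\<close> map \<open>F\<close> with values in the subspace \<open>W\<close>. The choice, for each \<open>x\<close>, of
  an SVD of the derivative enters through the singular values \<open>\<sigma> x\<close> and the left singular vectors
  \<open>u x\<close>; it is constrained by \<open>is_svd\<close> wherever this predicate is used.
\<close>

definition weakly_aligned ::
  "'b::euclidean_space set \<Rightarrow> ('a::euclidean_space \<Rightarrow> 'b) \<Rightarrow>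
    ('a \<Rightarrow> nat \<Rightarrow> real) \<Rightarrow> ('a \<Rightarrow> nat \<Rightarrow> 'b) \<Rightarrow>
    'b \<Rightarrow> (real \<Rightarrow> real) \<Rightarrow> (real \<Rightarrow> real) \<Rightarrow> bool" where
  "weakly_aligned W F \<sigma> u zstar \<delta> s \<longleftrightarrow>
     zstar \<in> range F \<and>
     (\<forall>\<rho>>0. 0 < \<delta> \<rho> \<and> 0 < s \<rho>) \<and>
     (\<forall>\<rho>>0. \<forall>x. F x \<in> cball zstar (\<delta> \<rho>) \<longrightarrow>
        (\<exists>j\<in>{1..min DIM('a) (dim W)}.
           norm ((F x - zstar) - orth_proj (span (u x ` {1..j})) (F x - zstar))
             \<le> \<rho> * norm (F x - zstar) \<and>
           (\<sigma> x j)\<^sup>2 \<ge> s \<rho> * norm (F x - zstar)))"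

definition F_sym :: "real^'r^'d \<Rightarrow> real^'d^'d" where
  "F_sym X = X ** transpose X"

lemma F_sym_in_sym_mats: "F_sym X \<in> sym_mats"
  by (simp add: sym_mats_def F_sym_def matrix_transpose_mul)

text \<open>\<open>F_sym\<close> is differentiable everywhere, so \<open>deriv_at F_sym X\<close> is its actual derivative.\<close>

lemma F_sym_has_derivative:
  "(F_sym has_derivative (\<lambda>H. X ** transpose H + H ** transpose X)) (at X)"
proof -
  have bl: "bounded_bilinear (\<lambda>(A::real^'r^'d) (B::real^'r^'d). A ** transpose B)"
    unfolding bilinear_conv_bounded_bilinear[symmetric] bilinear_def
  proof (intro conjI allI linearI)
    fix X A B :: "real^'r^'d" and c :: real
    show "X ** transpose (A + B) = X ** transpose A + X ** transpose B"
      by (simp add: matrix_matrix_mult_def transpose_def vec_eq_iff sum.distrib distrib_left)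
    show "X ** transpose (c *\<^sub>R A) = c *\<^sub>R (X ** transpose A)"
      by (simp add: matrix_matrix_mult_def transpose_def vec_eq_iff
          sum_distrib_left mult.left_commute)
    show "(A + B) ** transpose X = A ** transpose X + B ** transpose X"
      by (simp add: matrix_matrix_mult_def vec_eq_iff sum.distrib distrib_right)
    show "(c *\<^sub>R A) ** transpose X = c *\<^sub>R (A ** transpose X)"
      by (simp add: matrix_matrix_mult_def vec_eq_iff sum_distrib_left mult.assoc)
  qed
  have "((\<lambda>X. X ** transpose X) has_derivative
      (\<lambda>H. X ** transpose H + H ** transpose X)) (at X)"
    using bounded_bilinear.FDERIV[OF bl has_derivative_ident has_derivative_ident] .
  then show ?thesis
    by (simp add: F_sym_def[abs_def])
qed

lemma deriv_at_F_sym: "deriv_at F_sym X = (\<lambda>H. X ** transpose H + H ** transpose X)"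
  by (rule frechet_derivative_at[OF F_sym_has_derivative, symmetric])

end

theory Submission
  imports Defs
begin

text \<open>
  Write \<open>Z = X X\<^sup>T\<close>, \<open>\<epsilon>\<close> for the Frobenius norm of \<open>Z - Zstar\<close>, and \<open>m\<close> for the least positive
  eigenvalue of \<open>Zstar\<close>. The derivative \<open>A\<close> of the map at \<open>X\<close> satisfies
  \<open>A A\<^sup>* S = 2 (Z S + S Z)\<close>, so if \<open>q\<close> is an orthonormal eigenbasis of \<open>Z\<close> with eigenvalues \<open>l\<close>, the
  nonzero squared singular values of \<open>A\<close> are the nonzero numbers among the \<open>2 (l i + l k)\<close>, and the
  corresponding left singular spaces are spanned by the symmetrized products of \<open>q i\<close> and \<open>q k\<close>.
  Suppose \<open>\<epsilon> > 0\<close>, the other case being trivial. Put \<open>\<tau> = s \<epsilon>\<close> and let \<open>j\<close> be the last index with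
  \<open>(\<sigma> j)\<^sup>2 \<ge> \<tau>\<close>. In the basis \<open>q\<close>, projecting away the top \<open>j\<close> left singular vectors then simply
  keeps the entries \<open>(i, k)\<close> of \<open>Z - Zstar\<close> with \<open>2 (l i + l k) < \<tau>\<close> and deletes all others
  (\<open>residual_entry\<close>). These entries lie in the block where both eigenvalues are below \<open>\<tau> / 2\<close>.

  The matrix \<open>Z\<close> contributes to this block diagonal entries below \<open>\<tau> / 4\<close>. Since at least \<open>rank Zstar\<close>
  eigenvalues of \<open>Z\<close> are outside the block (\<open>card_high_eigenvalues_ge_rank\<close>) and at most \<open>r\<close> are
  nonzero, at most \<open>r - rank Zstar\<close> of the entries from \<open>Z\<close> are nonzero; the value of \<open>s\<close> is such that their squares
  sum to at most half of \<open>(\<rho> \<epsilon>)\<^sup>2\<close>.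

  The block of \<open>Zstar\<close> is of second order, with norm at most \<open>\<epsilon>\<^sup>2 / m\<close> (\<open>low_block_bound\<close>): a
  semidefinite matrix with spectral gap \<open>m\<close> satisfies \<open>Zstar\<^sup>2 \<ge> m Zstar\<close>, and comparing traces over the
  block bounds the block by the off-diagonal part, which is part of the perturbation. As
  \<open>\<epsilon> \<le> \<rho> m / sqrt 2\<close>, this block accounts for the other half of \<open>(\<rho> \<epsilon>)\<^sup>2\<close>.

  The Lipschitz bound for the derivative is the submultiplicativity of the Frobenius norm.
\<close>

section \<open>Spectral theorem for symmetric real matrices\<close>

text \<open>
  Along the line \<open>x - t y\<close> the form is a nonnegative quadratic in \<open>t\<close>, so its discriminant is not
  positive; if \<open>y \<bullet> f y = 0\<close> the quadratic in \<open>t\<close> degenerates to a line,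
  which stays nonnegative only if its slope vanishes.
\<close>

lemma semidefinite_form_Cauchy_Schwarz:
  fixes f :: "'a::real_inner \<Rightarrow> 'a"
  assumes lin: "linear f" and adj: "\<And>x y. x \<bullet> f y = f x \<bullet> y"
    and S: "subspace S" and pos: "\<And>x. x \<in> S \<Longrightarrow> 0 \<le> x \<bullet> f x"
    and x: "x \<in> S" and y: "y \<in> S"
  shows "(x \<bullet> f y)\<^sup>2 \<le> (x \<bullet> f x) * (y \<bullet> f y)"
proof -
  interpret linear f by (rule lin)
  let ?a = "y \<bullet> f y" and ?b = "x \<bullet> f y" and ?c = "x \<bullet> f x"
  have yx: "y \<bullet> f x = ?b" using adj[of x y] by (simp add: inner_commute)
  have q: "0 \<le> ?c - 2 * t * ?b + t\<^sup>2 * ?a" for t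
  proof -
    have "x - t *\<^sub>R y \<in> S" by (intro subspace_diff subspace_scale S x y)
    from pos[OF this] show ?thesis
      by (simp add: diff scale inner_diff_left inner_diff_right yx power2_eq_square
          algebra_simps)
  qed
  show ?thesis
  proof (cases "?a = 0")
    case True
    have "?b = 0"
    proof (rule ccontr)
      assume b: "?b \<noteq> 0"
      have "0 \<le> ?c - 2 * ((?c + 1) / (2 * ?b)) * ?b" using q[of "(?c + 1) / (2 * ?b)"] True by simp
      also have "\<dots> = -1" using b by (simp add: field_simps)
      finally show False by simp
    qed
    then show ?thesis using True by simp
  next
    case False
    then have a: "?a > 0" using pos[OF y] by simp
    have "0 \<le> ?c - 2 * (?b / ?a) * ?b + (?b / ?a)\<^sup>2 * ?a" by (rule q)
    also have "\<dots> = ?c - ?b\<^sup>2 / ?a" using a by (simp add: field_simps power2_eq_square)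
    finally show ?thesis using a by (simp add: field_simps)
  qed
qed

text \<open>
  The Rayleigh quotient attains its maximum \<open>c\<close> on the compact unit sphere of \<open>S\<close>. There the form
  of \<open>c I - f\<close> is semidefinite and vanishes at the maximizer \<open>x\<close>, so by Cauchy-Schwarz \<open>x\<close> lies
  in its radical, which makes \<open>x\<close> an eigenvector.
\<close>

lemma self_adjoint_eigenvector:
  fixes f :: "'a::euclidean_space \<Rightarrow> 'a"
  assumes lin: "linear f" and adj: "\<And>x y. x \<bullet> f y = f x \<bullet> y"
    and S: "subspace S" and inv: "f ` S \<subseteq> S" and ne: "S \<noteq> {0}"
  obtains x c where "x \<in> S" "norm x = 1" "f x = c *\<^sub>R x"
proof -
  interpret linear f by (rule lin)
  let ?K = "S \<inter> sphere 0 1"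
  have "compact ?K" using closed_subspace[OF S] by (intro closed_Int_compact) auto
  moreover obtain z where z: "z \<in> S" "z \<noteq> 0" using ne subspace_0[OF S] by auto
  have "(1 / norm z) *\<^sub>R z \<in> ?K" using z S by (auto intro: subspace_scale)
  then have "?K \<noteq> {}" by blast
  moreover have "continuous_on ?K (\<lambda>x. x \<bullet> f x)"
    using lin by (intro continuous_intros linear_continuous_on)
      (simp add: linear_conv_bounded_linear)
  ultimately obtain x where x: "x \<in> ?K" and max: "\<And>y. y \<in> ?K \<Longrightarrow> y \<bullet> f y \<le> x \<bullet> f x"
    using continuous_attains_sup by metis
  define c where "c = x \<bullet> f x"
  define g where "g y = c *\<^sub>R y - f y" for y
  have ling: "linear g" unfolding g_def
    by (intro linearI) (simp_all add: add scale algebra_simps)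
  have adjg: "a \<bullet> g b = g a \<bullet> b" for a b
    unfolding g_def by (simp add: inner_diff_left inner_diff_right adj)
  have pos: "0 \<le> y \<bullet> g y" if y: "y \<in> S" for y
  proof (cases "y = 0")
    case False
    then have "(1 / norm y) *\<^sub>R y \<in> ?K" using y S by (auto intro: subspace_scale)
    from max[OF this] have "(y \<bullet> f y) / (norm y)\<^sup>2 \<le> c"
      by (simp add: c_def scale power2_eq_square)
    then have "y \<bullet> f y \<le> c * (y \<bullet> y)" using False
      by (simp add: field_simps power2_norm_eq_inner)
    then show ?thesis by (simp add: g_def inner_diff_right)
  qed (simp add: g_def)
  have xS: "x \<in> S" "norm x = 1" using x by auto
  have gS: "g x \<in> S" unfolding g_def using inv xS S
    by (intro subspace_diff subspace_scale) auto
  have "x \<bullet> g x = 0"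
    using xS by (simp add: g_def inner_diff_right c_def dot_square_norm)
  \<comment> \<open>The radical: pairing \<open>x\<close> with \<open>g x\<close> itself gives \<open>g x = 0\<close>.\<close>
  with semidefinite_form_Cauchy_Schwarz[OF ling adjg S pos gS xS(1)]
  have "(g x \<bullet> g x)\<^sup>2 \<le> 0" by simp
  then have "g x = 0" by simp
  then have "f x = c *\<^sub>R x" by (simp add: g_def)
  with xS that show ?thesis by blast
qed

text \<open>
  Induction on the dimension: the orthogonal complement, within \<open>S\<close>, of an eigenvector is again
  invariant under a self-adjoint map.
\<close>

lemma self_adjoint_orthonormal_eigenbasis:
  fixes f :: "'a::euclidean_space \<Rightarrow> 'a"
  assumes lin: "linear f" and adj: "\<And>x y. x \<bullet> f y = f x \<bullet> y"
    and "subspace S" and "f ` S \<subseteq> S"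
  shows "\<exists>B. B \<subseteq> S \<and> card B = dim S \<and> finite B \<and> pairwise orthogonal B \<and>
    (\<forall>b\<in>B. norm b = 1) \<and> (\<forall>b\<in>B. \<exists>c. f b = c *\<^sub>R b)"
  using assms(3,4)
proof (induction "dim S" arbitrary: S rule: less_induct)
  case less
  show ?case
  proof (cases "S = {0}")
    case True
    then show ?thesis by (intro exI[of _ "{}"]) auto
  next
    case False
    obtain x c where x: "x \<in> S" "norm x = 1" "f x = c *\<^sub>R x"
      using self_adjoint_eigenvector[OF lin adj less.prems False] by blast
    have x0: "x \<noteq> 0" using x by auto
    define T where "T = {y \<in> S. \<forall>z\<in>span {x}. orthogonal y z}"
    have Talt: "T = {y \<in> S. y \<bullet> x = 0}"
      by (auto simp: T_def span_singleton orthogonal_def)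
    from dim_subspace_orthogonal_to_vectors[OF subspace_span less.prems(1), of "{x}"]
    have d: "dim T + dim (span {x}) = dim S"
      using x(1) less.prems(1) span_minimal[of "{x}" S]
      unfolding T_def by (simp add: orthogonal_commute)
    moreover have "dim (span {x}) = 1" using x0 by (simp add: dim_insert)
    ultimately have d: "dim S = Suc (dim T)" by simp
    have T: "subspace T" using less.prems(1) unfolding Talt
      by (auto simp: subspace_def inner_add_left)
    have "f ` T \<subseteq> T"
    proof
      fix z assume "z \<in> f ` T"
      then obtain y where y: "y \<in> S" "y \<bullet> x = 0" "z = f y" unfolding Talt by auto
      have "f y \<bullet> x = 0" using adj[of y x] y x by simp
      then show "z \<in> T" using y less.prems(2) by (auto simp: Talt)
    qed
    from less.hyps[OF _ T this] d obtain B where B: "B \<subseteq> T" "card B = dim T" "finite B"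
      "pairwise orthogonal B" "\<forall>b\<in>B. norm b = 1" "\<forall>b\<in>B. \<exists>c. f b = c *\<^sub>R b" by auto
    have "x \<notin> T" using x0 by (simp add: Talt)
    then have "x \<notin> B" using B by auto
    moreover have "pairwise orthogonal (insert x B)"
      using B(1,4) unfolding pairwise_insert
      by (auto simp: Talt orthogonal_def inner_commute)
    ultimately show ?thesis using B x d
      by (intro exI[of _ "insert x B"]) (auto simp: Talt)
  qed
qed

definition orthonormal_family :: "('i \<Rightarrow> 'a::real_inner) \<Rightarrow> bool" where
  "orthonormal_family q \<longleftrightarrow> (\<forall>i j. q i \<bullet> q j = (if i = j then 1 else 0))"

text \<open>
  The basis is indexed by the same type as the coordinates, so that it has the full number of
  elements and can serve as the columns of an orthogonal matrix.
\<close>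

definition eigenbasis :: "real^'d^'d \<Rightarrow> ('d \<Rightarrow> real^'d) \<Rightarrow> ('d \<Rightarrow> real) \<Rightarrow> bool" where
  "eigenbasis Z q l \<longleftrightarrow> orthonormal_family q \<and> (\<forall>i. Z *v q i = l i *\<^sub>R q i)"

lemma orthonormal_family_expand:
  fixes q :: "'d::finite \<Rightarrow> real^'d"
  assumes "orthonormal_family q"
  shows "(\<Sum>i\<in>UNIV. (q i \<bullet> x) *\<^sub>R q i) = x"
proof -
  have o: "q i \<bullet> q j = (if i = j then 1 else 0)" for i j
    using assms by (auto simp: orthonormal_family_def)
  have inj: "inj q"
  proof (rule injI)
    fix i j assume "q i = q j"
    then show "i = j" using o[of i j] o[of i i] by (metis zero_neq_one)
  qed
  have po: "pairwise orthogonal (range q)"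
    using o by (auto simp: pairwise_def orthogonal_def)
  have n: "norm b = 1" if "b \<in> range q" for b using that o by (auto simp: norm_eq_1)
  have "0 \<notin> range q" using n[of 0] by auto
  then have "independent (range q)" using po by (intro pairwise_orthogonal_independent)
  moreover have "card (range q) = DIM(real^'d)" using inj by (simp add: card_image)
  ultimately have "span (range q) = UNIV"
    using dim_span_eq_card_independent[of "range q"] by (simp add: dim_eq_full[symmetric] del: DIM_cart)
  then have "(\<Sum>b\<in>range q. (x \<bullet> b) *\<^sub>R b) = x"
    using po n by (intro orthonormal_basis_expand) auto
  then show ?thesis using inj by (simp add: sum.reindex inner_commute)
qed

lemma orthonormal_family_inner:
  fixes q :: "'d::finite \<Rightarrow> real^'d"
  assumes "orthonormal_family q"
  shows "x \<bullet> y = (\<Sum>i\<in>UNIV. (q i \<bullet> x) * (q i \<bullet> y))"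
proof -
  have "x \<bullet> y = (\<Sum>i\<in>UNIV. (q i \<bullet> x) *\<^sub>R q i) \<bullet> y"
    by (simp add: orthonormal_family_expand[OF assms])
  then show ?thesis by (simp add: inner_sum_left)
qed

lemma orthonormal_family_norm:
  fixes q :: "'d::finite \<Rightarrow> real^'d"
  assumes "orthonormal_family q"
  shows "(norm x)\<^sup>2 = (\<Sum>i\<in>UNIV. (q i \<bullet> x)\<^sup>2)"
  unfolding power2_norm_eq_inner orthonormal_family_inner[OF assms, of x x]
  by (simp add: power2_eq_square)

lemma sym_mats_inner: "Z \<in> sym_mats \<Longrightarrow> x \<bullet> (Z *v y) = (Z *v x) \<bullet> y"
  by (metis (mono_tags, lifting) dot_lmul_matrix mem_Collect_eq sym_mats_def transpose_matrix_vector)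

lemma subspace_sym_mats: "subspace (sym_mats :: (real^'d^'d) set)"
  by (auto simp: subspace_def sym_mats_def transpose_def vec_eq_iff)

lemma sym_mats_eigenbasis:
  fixes Z :: "real^'d^'d"
  assumes "Z \<in> sym_mats"
  obtains q l where "eigenbasis Z q l"
proof -
  obtain B where B: "card B = CARD('d)" "finite B"
      "pairwise orthogonal B" "\<forall>b\<in>B. norm b = 1" "\<forall>b\<in>B. \<exists>c. Z *v b = c *\<^sub>R b"
    using self_adjoint_orthonormal_eigenbasis
      [OF matrix_vector_mul_linear sym_mats_inner[OF assms] subspace_UNIV] by auto
  obtain q where q: "bij_betw q (UNIV :: 'd set) B"
    using B(1,2) finite_same_card_bij[of "UNIV :: 'd set" B] by auto
  then have qB: "q i \<in> B" for i by (auto simp: bij_betw_def)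
  obtain e where e: "\<forall>b\<in>B. Z *v b = e b *\<^sub>R b" using B(5) by metis
  have "q i \<bullet> q j = (if i = j then 1 else 0)" for i j
  proof (cases "i = j")
    case True then show ?thesis using qB[of j] B(4) by (simp add: norm_eq_1[symmetric])
  next
    case False
    then have "q i \<noteq> q j" using q by (auto simp: bij_betw_def inj_on_def)
    then show ?thesis using False B(3) qB by (auto simp: pairwise_def orthogonal_def)
  qed
  then have "eigenbasis Z q (e \<circ> q)" using e qB
    by (auto simp: eigenbasis_def orthonormal_family_def)
  then show ?thesis by (rule that)
qed

section \<open>Eigenvalues read off from the characteristic polynomial\<close>

lemma sum_const_poly: "(\<Sum>a\<in>A. [:f a:]) = [:\<Sum>a\<in>A. f a:]"
  by (induction A rule: infinite_finite_induct) auto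

text \<open>
  With \<open>C = x I - Z\<close>, the eigenvectors as the columns of \<open>Q\<close>, and \<open>D\<close> the diagonal matrix of
  the factors \<open>x - l i\<close>, all over the polynomial ring, \<open>C Q = Q D\<close> and \<open>Q\<^sup>T Q = 1\<close>. The determinant
  of \<open>Q\<close> is therefore nonzero and cancels.
\<close>

lemma char_polynomial_eigenbasis:
  fixes Z :: "real^'d^'d"
  assumes "eigenbasis Z q l"
  shows "char_polynomial Z = (\<Prod>i\<in>UNIV. [:- l i, 1:])"
proof -
  define C :: "real poly^'d^'d" where
    "C = (\<chi> i j. (if i = j then [:0, 1:] else 0) - [:Z $ i $ j:])"
  define Q :: "real poly^'d^'d" where "Q = (\<chi> a i. [:q i $ a:])"
  define D :: "real poly^'d^'d" where "D = (\<chi> i j. if i = j then [:- l i, 1:] else 0)"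
  have Zq: "(\<Sum>b\<in>UNIV. Z $ a $ b * q i $ b) = l i * q i $ a" for a i
  proof -
    have "(Z *v q i) $ a = (l i *\<^sub>R q i) $ a" using assms by (simp add: eigenbasis_def)
    then show ?thesis by (simp add: matrix_vector_mult_def)
  qed
  have "C ** Q = Q ** D"
  proof -
    have "(C ** Q) $ a $ i = (Q ** D) $ a $ i" for a i
    proof -
      have "(C ** Q) $ a $ i =
          (\<Sum>b\<in>UNIV. if a = b then [:0, 1:] * [:q i $ b:] else 0)
            - (\<Sum>b\<in>UNIV. [:Z $ a $ b * q i $ b:])"
        unfolding sum_subtractf[symmetric] matrix_matrix_mult_def
        by (auto simp: C_def Q_def left_diff_distrib intro!: sum.cong)
      also have "\<dots> = [:q i $ a:] * [:- l i, 1:]"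
        by (simp add: sum_const_poly Zq)
      also have "\<dots> = (\<Sum>k\<in>UNIV. if k = i then [:q k $ a:] * [:- l k, 1:] else 0)"
        using sum.delta[of UNIV i "\<lambda>k. [:q k $ a:] * [:- l k, 1:]"]
        by (simp only: finite UNIV_I if_True)
      also have "\<dots> = (Q ** D) $ a $ i"
        by (simp add: matrix_matrix_mult_def Q_def D_def if_distrib[where f = "smult _"] cong: if_cong)
      finally show ?thesis .
    qed
    then show ?thesis by (simp add: vec_eq_iff)
  qed
  moreover have "transpose Q ** Q = mat 1"
  proof -
    have "(transpose Q ** Q) $ i $ j = [:q i \<bullet> q j:]" for i j
      by (simp add: transpose_def matrix_matrix_mult_def Q_def sum_const_poly inner_vec_def mult.commute)
    then show ?thesis
      using assms by (simp add: vec_eq_iff mat_def eigenbasis_def orthonormal_family_def one_pCons)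
  qed
  then have "det Q * det Q = 1" by (metis det_I det_mul det_transpose)
  then have "det Q \<noteq> 0" by auto
  moreover have "det C * det Q = det Q * det D" using \<open>C ** Q = Q ** D\<close> by (metis det_mul)
  ultimately have "det C = det D" by simp
  moreover have "det D = (\<Prod>i\<in>UNIV. D $ i $ i)"
    by (rule det_diagonal) (simp add: D_def)
  ultimately show ?thesis by (simp add: char_polynomial_def C_def D_def)
qed

lemma proots_char_polynomial:
  assumes "eigenbasis Z q l"
  shows "proots (char_polynomial Z) = image_mset l (mset_set UNIV)"
proof -
  have "(\<Sum>i\<in>A. {#l i#}) = image_mset l (mset_set A)" for A
    by (induction A rule: infinite_finite_induct) auto
  then show ?thesis
    by (simp add: char_polynomial_eigenbasis[OF assms] proots_prod)
qed

lemma filter_pos_decreasing: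
  fixes xs :: "real list"
  assumes "sorted_wrt (\<ge>) xs"
  shows "filter (\<lambda>x. 0 < x) xs = take (length (filter (\<lambda>x. 0 < x) xs)) xs"
  using assms
proof (induction xs)
  case (Cons x xs)
  show ?case
  proof (cases "0 < x")
    case False
    then have "filter (\<lambda>x. 0 < x) (x # xs) = []"
      using Cons.prems by (force simp: filter_empty_conv)
    then show ?thesis by simp
  qed (use Cons in auto)
qed simp

text \<open>
  The positive eigenvalues come first in the decreasing list, so at the index that counts them stands
  the smallest one. For a semidefinite matrix it is the gap between zero and the rest of the spectrum.
\<close>

lemma nth_eigenvalue_least_positive:
  fixes Z :: "real^'d^'d"
  assumes eb: "eigenbasis Z q l" and k: "card {i. 0 < l i} = k" "1 \<le> k"
  shows "0 < nth_eigenvalue Z k" and "0 < l i \<Longrightarrow> nth_eigenvalue Z k \<le> l i"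
proof -
  define M where "M = image_mset l (mset_set UNIV)"
  define xs where "xs = rev (sorted_list_of_multiset M)"
  have nth: "nth_eigenvalue Z k = xs ! (k - 1)"
    by (simp add: nth_eigenvalue_def proots_char_polynomial[OF eb] xs_def M_def)
  have mset: "mset xs = M" by (simp add: xs_def)
  have "sorted (rev xs)" by (simp add: xs_def)
  then have sorted: "sorted_wrt (\<ge>) xs" by (simp add: sorted_wrt_rev)
  have "length (filter (\<lambda>x. 0 < x) xs) = size (filter_mset (\<lambda>x. 0 < x) M)"
    by (metis mset mset_filter size_mset)
  also have "\<dots> = k" using k by (simp add: M_def filter_mset_image_mset)
  finally have "filter (\<lambda>x. 0 < x) xs = take k xs" and len: "length (filter (\<lambda>x. 0 < x) xs) = k"
    using filter_pos_decreasing[OF sorted] by simp_all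
  note f = this(1)
  have kl: "k \<le> length xs" using len length_filter_le[of "\<lambda>x. 0 < x" xs] by simp
  have "xs ! (k - 1) \<in> set (take k xs)"
    using kl k(2) by (auto simp: in_set_conv_nth intro!: exI[of _ "k - 1"])
  then show "0 < nth_eigenvalue Z k" unfolding nth f[symmetric] by simp
  show "nth_eigenvalue Z k \<le> l i" if "0 < l i"
  proof -
    have "l i \<in># M" by (simp add: M_def)
    then have "l i \<in> set xs" by (simp add: mset[symmetric])
    then have "l i \<in> set (take k xs)" unfolding f[symmetric] using that by simp
    then obtain n where "n < k" "l i = xs ! n" by (auto simp: in_set_conv_nth)
    then show ?thesis unfolding nth using sorted kl
      by (cases "n = k - 1") (auto simp: sorted_wrt_iff_nth_less)
  qed
qed

lemma eigenbasis_coord: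
  assumes "eigenbasis Z q l"
  shows "q i \<bullet> (Z *v x) = l i * (q i \<bullet> x)"
proof -
  have on: "orthonormal_family q" and ev: "\<And>i. Z *v q i = l i *\<^sub>R q i"
    using assms by (auto simp: eigenbasis_def)
  have "Z *v x = Z *v (\<Sum>k\<in>UNIV. (q k \<bullet> x) *\<^sub>R q k)"
    by (simp add: orthonormal_family_expand[OF on])
  also have "\<dots> = (\<Sum>k\<in>UNIV. (q k \<bullet> x) *\<^sub>R (l k *\<^sub>R q k))"
    by (simp add: linear_sum[OF matrix_vector_mul_linear] linear_scale[OF matrix_vector_mul_linear] ev
        del: scaleR_scaleR)
  finally have "q i \<bullet> (Z *v x) = (\<Sum>k\<in>UNIV. (q k \<bullet> x) * (l k * (q i \<bullet> q k)))"
    by (simp add: inner_sum_right mult.assoc)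
  also have "\<dots> = (\<Sum>k\<in>UNIV. if k = i then l i * (q i \<bullet> x) else 0)"
    using on by (intro sum.cong) (auto simp: orthonormal_family_def)
  finally show ?thesis by simp
qed

lemma eigenbasis_quadratic_form:
  assumes "eigenbasis Z q l"
  shows "x \<bullet> (Z *v x) = (\<Sum>i\<in>UNIV. l i * (q i \<bullet> x)\<^sup>2)"
proof -
  have "orthonormal_family q" using assms by (simp add: eigenbasis_def)
  from orthonormal_family_inner[OF this, of x "Z *v x"] show ?thesis
    by (simp add: eigenbasis_coord[OF assms] power2_eq_square mult_ac)
qed

lemma orthonormal_family_independent:
  assumes "orthonormal_family q"
  shows "independent (q ` A)" and "inj_on q A"
proof -
  have o: "q i \<bullet> q j = (if i = j then 1 else 0)" for i j
    using assms by (auto simp: orthonormal_family_def)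
  show "independent (q ` A)"
  proof (rule pairwise_orthogonal_independent)
    show "pairwise orthogonal (q ` A)" using o by (auto simp: pairwise_def orthogonal_def)
    show "0 \<notin> q ` A" using o by (metis imageE inner_zero_left zero_neq_one)
  qed
  show "inj_on q A"
  proof (rule inj_onI)
    fix i j assume "q i = q j"
    then show "i = j" using o[of i j] o[of i i] by (metis zero_neq_one)
  qed
qed

lemma dim_span_orthonormal_family:
  fixes q :: "'d::finite \<Rightarrow> 'a::euclidean_space"
  assumes "orthonormal_family q"
  shows "dim (span (q ` A)) = card A"
  using dim_span_eq_card_independent[OF orthonormal_family_independent(1)[OF assms, of A]]
  by (simp only: card_image[OF orthonormal_family_independent(2)[OF assms]])

lemma rank_eigenbasis:
  fixes Z :: "real^'d^'d"
  assumes eb: "eigenbasis Z q l"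
  shows "rank Z = card {i. l i \<noteq> 0}"
proof -
  have on: "orthonormal_family q" and ev: "\<And>i. Z *v q i = l i *\<^sub>R q i"
    using assms by (auto simp: eigenbasis_def)
  have "range ((*v) Z) = span (q ` {i. l i \<noteq> 0})"
  proof
    show "range ((*v) Z) \<subseteq> span (q ` {i. l i \<noteq> 0})"
    proof clarify
      fix x
      have "Z *v x = (\<Sum>i\<in>UNIV. (l i * (q i \<bullet> x)) *\<^sub>R q i)"
        using orthonormal_family_expand[OF on, of "Z *v x"] by (simp add: eigenbasis_coord[OF eb])
      also have "\<dots> = (\<Sum>i\<in>{i. l i \<noteq> 0}. (l i * (q i \<bullet> x)) *\<^sub>R q i)"
        by (rule sum.mono_neutral_right) auto
      also have "\<dots> \<in> span (q ` {i. l i \<noteq> 0})"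
        by (intro span_sum span_scale span_base) auto
      finally show "Z *v x \<in> span (q ` {i. l i \<noteq> 0})" .
    qed
    have "q i \<in> range ((*v) Z)" if "l i \<noteq> 0" for i
    proof -
      have "q i = Z *v ((1 / l i) *\<^sub>R q i)"
        using that by (simp add: linear_scale[OF matrix_vector_mul_linear] ev)
      then show ?thesis by blast
    qed
    moreover have "subspace (range ((*v) Z))"
      by (intro linear_subspace_image matrix_vector_mul_linear subspace_UNIV)
    ultimately show "span (q ` {i. l i \<noteq> 0}) \<subseteq> range ((*v) Z)"
      by (intro span_minimal) auto
  qed
  then show ?thesis
    by (simp only: rank_dim_range dim_span_orthonormal_family[OF on])
qed

section \<open>Frobenius norm and the Lipschitz bound\<close>

lemma norm_matrix_rows: "(norm (A::real^'m^'n))\<^sup>2 = (\<Sum>i\<in>UNIV. (norm (A $ i))\<^sup>2)"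
  by (simp add: norm_vec_def L2_set_def sum_nonneg)

lemma norm_transpose: "norm (transpose (A::real^'m^'n)) = norm A"
proof -
  have "(norm (transpose A))\<^sup>2 = (norm A)\<^sup>2"
    unfolding norm_matrix_rows power2_norm_eq_inner inner_vec_def transpose_def
    by (simp, rule sum.swap)
  then show ?thesis by simp
qed

lemma norm_matrix_vector_mult: "norm ((A::real^'m^'n) *v x) \<le> norm A * norm x"
proof (rule power2_le_imp_le)
  have "(norm (A *v x))\<^sup>2 = (\<Sum>i\<in>UNIV. (A $ i \<bullet> x)\<^sup>2)"
    unfolding power2_norm_eq_inner inner_vec_def[of "A *v x"]
    by (simp add: matrix_vector_mul_component power2_eq_square)
  also have "\<dots> \<le> (\<Sum>i\<in>UNIV. (norm (A $ i))\<^sup>2 * (norm x)\<^sup>2)"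
    by (intro sum_mono) (simp add: Cauchy_Schwarz_ineq power2_norm_eq_inner)
  also have "\<dots> = (norm A * norm x)\<^sup>2"
    by (simp add: norm_matrix_rows[of A] power_mult_distrib sum_distrib_right)
  finally show "(norm (A *v x))\<^sup>2 \<le> (norm A * norm x)\<^sup>2" .
qed simp

lemma norm_matrix_matrix_mult: "norm ((A::real^'m^'n) ** (B::real^'p^'m)) \<le> norm A * norm B"
proof (rule power2_le_imp_le)
  have row: "(A ** B) $ i = transpose B *v (A $ i)" for i
    by (simp add: vec_eq_iff matrix_matrix_mult_def matrix_vector_mult_def transpose_def mult.commute
      del: transpose_matrix_vector)
  have "(norm (A ** B))\<^sup>2 \<le> (\<Sum>i\<in>UNIV. (norm B * norm (A $ i))\<^sup>2)"
    unfolding norm_matrix_rows[of "A ** B"] row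
    by (intro sum_mono power_mono order_trans[OF norm_matrix_vector_mult])
       (simp_all add: norm_transpose del: transpose_matrix_vector)
  also have "\<dots> = (norm A * norm B)\<^sup>2"
    unfolding power_mult_distrib sum_distrib_left[symmetric] norm_matrix_rows[of A, symmetric]
    by (rule mult.commute)
  finally show "(norm (A ** B))\<^sup>2 \<le> (norm A * norm B)\<^sup>2" .
qed simp

lemma matrix_inner_orthonormal:
  fixes R S :: "real^'d^'n" and q :: "'d \<Rightarrow> real^'d"
  assumes "orthonormal_family q"
  shows "R \<bullet> S = (\<Sum>k\<in>UNIV. (R *v q k) \<bullet> (S *v q k))"
proof -
  have "R \<bullet> S = (\<Sum>a\<in>UNIV. \<Sum>k\<in>UNIV. (q k \<bullet> R $ a) * (q k \<bullet> S $ a))"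
    by (simp add: inner_vec_def[of R] orthonormal_family_inner[OF assms, of "R $ a" "S $ a" for a])
  also have "\<dots> = (\<Sum>k\<in>UNIV. (R *v q k) \<bullet> (S *v q k))"
    by (subst sum.swap)
       (simp add: inner_vec_def[of "_ *v _"] matrix_vector_mul_component inner_commute)
  finally show ?thesis .
qed

lemma norm_matrix_orthonormal:
  fixes R :: "real^'d^'d" and q :: "'d \<Rightarrow> real^'d"
  assumes "orthonormal_family q"
  shows "(norm R)\<^sup>2 = (\<Sum>k\<in>UNIV. \<Sum>i\<in>UNIV. (q i \<bullet> (R *v q k))\<^sup>2)"
  using matrix_inner_orthonormal[OF assms, of R R]
  by (simp add: power2_norm_eq_inner[symmetric] orthonormal_family_norm[OF assms])

lemma onorm_deriv_F_sym_diff: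
  fixes X Y :: "real^'r^'d"
  shows "onorm (\<lambda>H. deriv_at F_sym X H - deriv_at F_sym Y H) \<le> 2 * norm (X - Y)"
proof (rule onorm_le)
  fix H :: "real^'r^'d"
  have "deriv_at F_sym X H - deriv_at F_sym Y H
      = (X - Y) ** transpose H + H ** transpose (X - Y)"
    by (simp add: deriv_at_F_sym vec_eq_iff matrix_matrix_mult_def transpose_def sum_subtractf
        algebra_simps)
  also have "norm \<dots> \<le> norm (X - Y) * norm H + norm H * norm (X - Y)"
    by (intro order_trans[OF norm_triangle_ineq] add_mono order_trans[OF norm_matrix_matrix_mult])
       (simp_all add: norm_transpose)
  finally show "norm (deriv_at F_sym X H - deriv_at F_sym Y H) \<le> 2 * norm (X - Y) * norm H"
    by (simp add: algebra_simps)
qed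

section \<open>Positive semidefinite matrices and the range of the map\<close>

lemma psdD:
  assumes "psd Z" shows "Z \<in> sym_mats" and "0 \<le> x \<bullet> (Z *v x)"
  using assms by (auto simp: psd_def)

lemma psd_eigenvalue_nonneg:
  assumes "psd Z" and eb: "eigenbasis Z q l"
  shows "0 \<le> l i"
proof -
  have "0 \<le> q i \<bullet> (Z *v q i)" by (rule psdD(2)[OF assms(1)])
  also have "\<dots> = l i" using eb by (simp add: eigenbasis_coord[OF eb] eigenbasis_def orthonormal_family_def)
  finally show ?thesis .
qed

lemma psd_F_sym: "psd (F_sym X)"
proof -
  have "x \<bullet> (F_sym X *v x) = (transpose X *v x) \<bullet> (transpose X *v x)" for x
    by (simp add: F_sym_def matrix_vector_mul_assoc[symmetric] dot_lmul_matrix)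
  then show ?thesis unfolding psd_def using F_sym_in_sym_mats[of X] by simp
qed

lemma rank_F_sym:
  fixes X :: "real^'r^'d"
  shows "rank (F_sym X) \<le> CARD('r)"
  using rank_mul_le_left[of X "transpose X"] rank_bound[of X] unfolding F_sym_def by linarith

text \<open>
  The columns of the preimage are the vectors \<open>sqrt (l i) q i\<close> for the nonzero eigenvalues, placed at
  distinct column positions by an injection \<open>f\<close>, with zero columns elsewhere.
\<close>

lemma psd_in_range_F_sym:
  fixes Z :: "real^'d^'d"
  assumes psd: "psd Z" and rank: "rank Z \<le> CARD('r::finite)"
  shows "Z \<in> range (F_sym :: real^'r^'d \<Rightarrow> _)"
proof -
  obtain q l where eb: "eigenbasis Z q l" using sym_mats_eigenbasis[OF psdD(1)[OF psd]] .
  then have on: "orthonormal_family q" and ev: "\<And>i. Z *v q i = l i *\<^sub>R q i"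
    by (auto simp: eigenbasis_def)
  have l0: "0 \<le> l i" for i by (rule psd_eigenvalue_nonneg[OF psd eb])
  define P where "P = {i. l i \<noteq> 0}"
  have "card P \<le> card (UNIV :: 'r set)" using rank by (simp add: P_def rank_eigenbasis[OF eb])
  then obtain f :: "'d \<Rightarrow> 'r" where f: "inj_on f P"
    using card_le_inj[of P "UNIV :: 'r set"] by auto
  define X :: "real^'r^'d" where
    "X = (\<chi> a c. \<Sum>i\<in>P. if f i = c then sqrt (l i) * q i $ a else 0)"
  have Xf: "X $ a $ f i = sqrt (l i) * q i $ a" if "i \<in> P" for a i
  proof -
    have "X $ a $ f i = (\<Sum>k\<in>P. if k = i then sqrt (l k) * q k $ a else 0)"
      unfolding X_def vec_lambda_beta
      by (rule sum.cong[OF refl]) (use f that in \<open>auto simp: inj_on_def\<close>)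
    then show ?thesis using that by simp
  qed
  have X0: "X $ a $ c = 0" if "c \<notin> f ` P" for a c
    unfolding X_def using that by (auto intro!: sum.neutral)
  have entry: "F_sym X $ a $ b = (\<Sum>i\<in>UNIV. l i * q i $ a * q i $ b)" for a b
  proof -
    have "F_sym X $ a $ b = (\<Sum>c\<in>UNIV. X $ a $ c * X $ b $ c)"
      by (simp add: F_sym_def matrix_matrix_mult_def transpose_def)
    also have "\<dots> = (\<Sum>c\<in>f ` P. X $ a $ c * X $ b $ c)"
      by (rule sum.mono_neutral_right) (auto simp: X0)
    also have "\<dots> = (\<Sum>i\<in>P. l i * q i $ a * q i $ b)"
      using f l0 by (auto simp: sum.reindex Xf intro!: sum.cong)
    also have "\<dots> = (\<Sum>i\<in>UNIV. l i * q i $ a * q i $ b)"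
      by (rule sum.mono_neutral_left) (auto simp: P_def)
    finally show ?thesis .
  qed
  have "F_sym X *v x = Z *v x" for x
  proof -
    have "(F_sym X *v x) $ a = (Z *v x) $ a" for a
    proof -
      have "(F_sym X *v x) $ a = (\<Sum>b\<in>UNIV. \<Sum>i\<in>UNIV. l i * q i $ a * q i $ b * x $ b)"
        by (simp add: matrix_vector_mult_def entry sum_distrib_right)
      also have "\<dots> = (\<Sum>i\<in>UNIV. l i * q i $ a * (q i \<bullet> x))"
        by (subst sum.swap) (simp add: inner_vec_def sum_distrib_left mult.assoc)
      also have "\<dots> = (\<Sum>i\<in>UNIV. (q i \<bullet> (Z *v x)) *\<^sub>R q i) $ a"
        by (simp add: eigenbasis_coord[OF eb] mult_ac)
      finally show ?thesis by (simp add: orthonormal_family_expand[OF on])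
    qed
    then show ?thesis by (simp add: vec_eq_iff)
  qed
  then have "F_sym X = Z" by (simp add: matrix_eq)
  then show ?thesis by blast
qed

section \<open>Singular vectors of the derivative\<close>

definition outer :: "real^'n \<Rightarrow> real^'m \<Rightarrow> real^'m^'n" where
  "outer x y = (\<chi> a b. x $ a * y $ b)"

lemma inner_outer: "M \<bullet> outer x y = x \<bullet> (M *v y)"
  by (simp add: inner_vec_def outer_def matrix_vector_mult_def sum_distrib_left mult_ac)

lemma mult_outer: "Z ** outer x y = outer (Z *v x) y"
  by (simp add: vec_eq_iff outer_def matrix_matrix_mult_def matrix_vector_mult_def
      sum_distrib_right mult.assoc)

lemma outer_mult: "outer x y ** Z = outer x (transpose Z *v y)"
  by (simp add: vec_eq_iff outer_def matrix_matrix_mult_def matrix_vector_mult_def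
      transpose_def sum_distrib_left mult_ac del: transpose_matrix_vector)

lemma outer_scaleR: "outer (c *\<^sub>R x) y = c *\<^sub>R outer x y" "outer x (c *\<^sub>R y) = c *\<^sub>R outer x y"
  by (simp_all add: vec_eq_iff outer_def)

lemma inner_transpose: "transpose M \<bullet> transpose N = M \<bullet> (N :: real^'m^'n)"
  unfolding inner_vec_def transpose_def by (simp, rule sum.swap)

lemma inner_mult_transpose: "(H ** transpose X) \<bullet> S = (H :: real^'r^'d) \<bullet> (S ** X)"
proof -
  have "(H ** transpose X) \<bullet> S = (\<Sum>a\<in>UNIV. \<Sum>b\<in>UNIV. \<Sum>c\<in>UNIV. H $ a $ c * X $ b $ c * S $ a $ b)"
    by (simp add: inner_vec_def matrix_matrix_mult_def transpose_def sum_distrib_right)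
  also have "\<dots> = (\<Sum>a\<in>UNIV. \<Sum>c\<in>UNIV. \<Sum>b\<in>UNIV. H $ a $ c * X $ b $ c * S $ a $ b)"
    by (intro sum.cong refl sum.swap)
  also have "\<dots> = H \<bullet> (S ** X)"
    by (simp add: inner_vec_def matrix_matrix_mult_def sum_distrib_left mult_ac)
  finally show ?thesis .
qed

lemma deriv_F_sym_adjoint:
  fixes X :: "real^'r^'d"
  assumes "S \<in> sym_mats"
  shows "deriv_at F_sym X H \<bullet> S = H \<bullet> (2 *\<^sub>R (S ** X))"
proof -
  have S: "transpose S = S" using assms by (simp add: sym_mats_def)
  have "(X ** transpose H) \<bullet> S = (H ** transpose X) \<bullet> S"
    using inner_transpose[of "H ** transpose X" S] by (simp add: matrix_transpose_mul S)
  then show ?thesis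
    by (simp add: deriv_at_F_sym inner_add_left inner_mult_transpose)
qed

text \<open>
  Let \<open>A\<close> be the derivative at \<open>X\<close> and \<open>Z = X X\<^sup>T\<close>. Both sides are \<open>A A\<^sup>* S\<close>: the left one
  computed from the singular value decomposition, the right one from the formula for \<open>A\<^sup>*\<close>. This
  ties every choice of singular vectors to the spectrum of \<open>Z\<close>.
\<close>

lemma svd_deriv_F_sym_gram:
  fixes X :: "real^'r^'d" and u :: "nat \<Rightarrow> real^'d^'d"
  assumes svd: "is_svd sym_mats (deriv_at F_sym X) \<sigma> u v" and S: "S \<in> sym_mats"
  shows "(\<Sum>i\<in>{1..min DIM(real^'r^'d) (dim (sym_mats :: (real^'d^'d) set))}.
            ((\<sigma> i)\<^sup>2 * (u i \<bullet> S)) *\<^sub>R u i)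
         = 2 *\<^sub>R (F_sym X ** S + S ** F_sym X)"
proof -
  define I where "I = {1..min DIM(real^'r^'d) (dim (sym_mats :: (real^'d^'d) set))}"
  have uu: "u i \<bullet> u j = (if i = j then 1 else 0)" and vv: "v i \<bullet> v j = (if i = j then 1 else 0)"
    if "i \<in> I" "j \<in> I" for i j using svd that unfolding is_svd_def Let_def I_def by blast+
  have A: "deriv_at F_sym X H = (\<Sum>i\<in>I. (\<sigma> i * (v i \<bullet> H)) *\<^sub>R u i)" for H
    using svd unfolding is_svd_def Let_def I_def by blast
  have fin: "finite I" by (simp add: I_def)
  \<comment> \<open>The coefficients of \<open>A\<^sup>* S\<close> along the right singular vectors, from \<open>A (v i) = \<sigma> i u i\<close>.\<close>
  have Sv: "v i \<bullet> (2 *\<^sub>R (S ** X)) = \<sigma> i * (u i \<bullet> S)" if i: "i \<in> I" for i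
  proof -
    have "deriv_at F_sym X (v i) = (\<Sum>k\<in>I. if k = i then \<sigma> i *\<^sub>R u i else 0)"
      unfolding A using vv[OF _ i] by (intro sum.cong) auto
    also have "\<dots> = \<sigma> i *\<^sub>R u i" using fin i by simp
    finally show ?thesis using deriv_F_sym_adjoint[OF S, of X "v i"] by simp
  qed
  have "(\<Sum>i\<in>I. ((\<sigma> i)\<^sup>2 * (u i \<bullet> S)) *\<^sub>R u i) = deriv_at F_sym X (2 *\<^sub>R (S ** X))"
    unfolding A by (intro sum.cong refl) (simp add: Sv[simplified] power2_eq_square mult.left_commute)
  also have "\<dots> = 2 *\<^sub>R (X ** transpose (S ** X) + (S ** X) ** transpose X)"
    by (simp add: deriv_at_F_sym vec_eq_iff matrix_matrix_mult_def transpose_def sum_distrib_left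
        distrib_left mult_ac)
  also have "\<dots> = 2 *\<^sub>R (F_sym X ** S + S ** F_sym X)"
    using S by (simp add: F_sym_def matrix_transpose_mul matrix_mul_assoc sym_mats_def)
  finally show ?thesis unfolding I_def .
qed

lemma expansion_eigenvector_coefficient:
  fixes u :: "'i \<Rightarrow> 'b::real_inner"
  assumes fin: "finite I" and on: "\<And>i j. i \<in> I \<Longrightarrow> j \<in> I \<Longrightarrow> u i \<bullet> u j = (if i = j then 1 else 0)"
    and eig: "(\<Sum>i\<in>I. (c i * (u i \<bullet> w)) *\<^sub>R u i) = \<mu> *\<^sub>R w" and j: "j \<in> I"
  shows "c j * (u j \<bullet> w) = \<mu> * (u j \<bullet> w)"
proof -
  have "u j \<bullet> (\<Sum>i\<in>I. (c i * (u i \<bullet> w)) *\<^sub>R u i) = (\<Sum>i\<in>I. if i = j then c j * (u j \<bullet> w) else 0)"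
    unfolding inner_sum_right using on[OF j] by (intro sum.cong) auto
  also have "\<dots> = c j * (u j \<bullet> w)" using fin j by simp
  finally show ?thesis by (metis eig inner_scaleR_right)
qed

definition sym_outer :: "real^'d \<Rightarrow> real^'d \<Rightarrow> real^'d^'d" where
  "sym_outer x y = outer x y + outer y x"

lemma sym_outer_in_sym_mats: "sym_outer x y \<in> sym_mats"
  by (simp add: sym_mats_def sym_outer_def vec_eq_iff transpose_def outer_def)

lemma inner_sym_outer:
  assumes "M \<in> sym_mats"
  shows "M \<bullet> sym_outer x y = 2 * (x \<bullet> (M *v y))"
  using sym_mats_inner[OF assms, of x y]
  by (simp add: sym_outer_def inner_add_right inner_outer inner_commute)

lemma matrix_add_mult_distrib: "(A + B) ** C = A ** C + B ** C"
  by (vector matrix_matrix_mult_def sum.distrib[symmetric] field_simps)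

text \<open>
  The symmetrized products of eigenvectors of \<open>Z\<close> are the eigenvectors of \<open>S \<mapsto> 2 (Z S + S Z)\<close>; the
  nonzero numbers among the eigenvalues \<open>2 (l i + l k)\<close> are the nonzero squared singular values of
  the derivative.
\<close>

lemma anticommutator_sym_outer:
  assumes eb: "eigenbasis Z q l" and Z: "Z \<in> sym_mats"
  shows "2 *\<^sub>R (Z ** sym_outer (q i) (q k) + sym_outer (q i) (q k) ** Z)
    = (2 * (l i + l k)) *\<^sub>R sym_outer (q i) (q k)"
proof -
  have ev: "\<And>i. Z *v q i = l i *\<^sub>R q i" and tr: "transpose Z = Z"
    using eb Z by (auto simp: eigenbasis_def sym_mats_def)
  have "Z ** sym_outer (q i) (q k) = l i *\<^sub>R outer (q i) (q k) + l k *\<^sub>R outer (q k) (q i)"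
    by (simp add: sym_outer_def matrix_add_ldistrib mult_outer ev outer_scaleR)
  moreover have "sym_outer (q i) (q k) ** Z = l k *\<^sub>R outer (q i) (q k) + l i *\<^sub>R outer (q k) (q i)"
    by (simp add: sym_outer_def matrix_add_mult_distrib outer_mult tr ev outer_scaleR
        del: transpose_matrix_vector)
  ultimately show ?thesis by (simp add: sym_outer_def algebra_simps)
qed

context
  fixes X :: "real^'r^'d" and \<sigma> :: "nat \<Rightarrow> real" and u :: "nat \<Rightarrow> real^'d^'d"
    and v :: "nat \<Rightarrow> real^'r^'d" and I :: "nat set" and q :: "'d \<Rightarrow> real^'d" and l :: "'d \<Rightarrow> real"
  assumes svd: "is_svd sym_mats (deriv_at F_sym X) \<sigma> u v"
    and I: "I = {1..min DIM(real^'r^'d) (dim (sym_mats :: (real^'d^'d) set))}"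
    and eb: "eigenbasis (F_sym X) q l"
begin

lemma left_singular_orthonormal:
  "i \<in> I \<Longrightarrow> j \<in> I \<Longrightarrow> u i \<bullet> u j = (if i = j then 1 else 0)"
  using svd unfolding is_svd_def Let_def I by blast

lemma left_singular_sym: "i \<in> I \<Longrightarrow> u i \<in> sym_mats"
  using svd unfolding is_svd_def Let_def I by blast

lemma gram_sym_outer:
  "(\<Sum>n\<in>I. ((\<sigma> n)\<^sup>2 * (u n \<bullet> sym_outer (q i) (q k))) *\<^sub>R u n)
    = (2 * (l i + l k)) *\<^sub>R sym_outer (q i) (q k)"
  using svd_deriv_F_sym_gram[OF svd sym_outer_in_sym_mats, of "q i" "q k"]
    anticommutator_sym_outer[OF eb F_sym_in_sym_mats, of i k] unfolding I by simp

lemma gram_sym_outer_coefficient: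
  assumes "n \<in> I" and "u n \<bullet> sym_outer (q i) (q k) \<noteq> 0"
  shows "(\<sigma> n)\<^sup>2 = 2 * (l i + l k)"
proof -
  have "finite I" by (simp add: I)
  from expansion_eigenvector_coefficient[OF this left_singular_orthonormal gram_sym_outer[of i k] assms(1)]
  show ?thesis using assms(2) by simp
qed

text \<open>
  When \<open>j\<close> is the last index with \<open>(\<sigma> j)\<^sup>2 \<ge> \<tau>\<close>, the span of the first \<open>j\<close> left singular vectors is
  the spectral subspace of \<open>S \<mapsto> 2 (Z S + S Z)\<close> for eigenvalues at least \<open>\<tau>\<close>, however the
  decomposition was chosen. Hence a symmetrized product of eigenvectors of \<open>Z\<close> is either inside that
  span, and the residual has no component along it, or orthogonal to the span, and the projection has
  none. Positivity of \<open>\<tau>\<close> keeps out the part of the range space that the decomposition does not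
  reach.
\<close>

lemma residual_entry:
  assumes j: "j \<in> I" and top: "\<And>n. n \<in> I \<Longrightarrow> n \<le> j \<longleftrightarrow> \<tau> \<le> (\<sigma> n)\<^sup>2" and \<tau>: "0 < \<tau>"
    and E: "E \<in> sym_mats"
  shows "(q i \<bullet> ((E - orth_proj (span (u ` {1..j})) E) *v q k))\<^sup>2
    \<le> (if 2 * (l i + l k) < \<tau> then (q i \<bullet> (E *v q k))\<^sup>2 else 0)"
proof -
  define w where "w = sym_outer (q i) (q k)"
  define \<mu> where "\<mu> = 2 * (l i + l k)"
  define U where "U = span (u ` {1..j})"
  define P where "P = orth_proj U E"
  have jI: "{1..j} \<subseteq> I" using j by (auto simp: I)
  have P: "P \<in> U" and R: "\<And>x. x \<in> U \<Longrightarrow> (E - P) \<bullet> x = 0"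
    using orth_proj_props[of U E] unfolding P_def orthogonal_def by (auto simp: U_def)
  have "U \<subseteq> sym_mats" unfolding U_def
    using left_singular_sym jI by (intro span_minimal subspace_sym_mats) auto
  then have sym: "E - P \<in> sym_mats" using P E subspace_diff[OF subspace_sym_mats] by blast
  have coeff: "u n \<bullet> w = 0 \<or> (\<sigma> n)\<^sup>2 = \<mu>" if "n \<in> I" for n
    using gram_sym_outer_coefficient[OF that] unfolding w_def \<mu>_def by blast
  have "(E - P) \<bullet> w = (if \<mu> < \<tau> then E \<bullet> w else 0)"
  proof (cases "\<mu> < \<tau>")
    case True
    have "orthogonal w x" if "x \<in> u ` {1..j}" for x
    proof -
      obtain n where n: "x = u n" "n \<in> I" "n \<le> j" using \<open>x \<in> u ` {1..j}\<close> jI by auto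
      then have "(\<sigma> n)\<^sup>2 \<noteq> \<mu>" using top[of n] True by auto
      then show ?thesis using coeff[OF n(2)] n(1) by (simp add: orthogonal_def inner_commute)
    qed
    then have "orthogonal w P" using P unfolding U_def by (intro orthogonal_to_span[of P]) auto
    then show ?thesis using True by (simp add: inner_diff_left orthogonal_def inner_commute[of P w])
  next
    case False
    have "\<mu> *\<^sub>R w = (\<Sum>n\<in>I. ((\<sigma> n)\<^sup>2 * (u n \<bullet> w)) *\<^sub>R u n)"
      using gram_sym_outer[of i k] by (simp add: w_def \<mu>_def)
    also have "\<dots> \<in> U"
    proof (rule subspace_sum)
      show "subspace U" by (simp add: U_def)
      fix n assume n: "n \<in> I"
      show "((\<sigma> n)\<^sup>2 * (u n \<bullet> w)) *\<^sub>R u n \<in> U"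
      proof (cases "u n \<bullet> w = 0")
        case True
        then show ?thesis by (simp add: U_def span_zero)
      next
        case nz: False
        then have "n \<le> j" using coeff[OF n] top[OF n] False by auto
        then show ?thesis using n unfolding U_def I by (intro span_scale span_base) auto
      qed
    qed
    finally have "(E - P) \<bullet> (\<mu> *\<^sub>R w) = 0" by (rule R)
    then show ?thesis using False \<tau> by simp
  qed
  then have "q i \<bullet> ((E - P) *v q k) = (if \<mu> < \<tau> then q i \<bullet> (E *v q k) else 0)"
    unfolding w_def inner_sym_outer[OF sym] inner_sym_outer[OF E] by (auto split: if_splits)
  then show ?thesis unfolding \<mu>_def P_def U_def by (simp split: if_splits)
qed

text \<open>
  Existence of the cut-off index: a diagonal product \<open>q i (q i)\<^sup>T\<close> is nonzero and has eigenvalue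
  \<open>4 l i > 0\<close>, so it meets some left singular vector with that squared singular value.
\<close>

lemma threshold_index:
  assumes \<tau>: "0 < \<tau>" and i: "\<tau> \<le> 4 * l i"
  obtains j where "j \<in> I" "\<And>n. n \<in> I \<Longrightarrow> n \<le> j \<longleftrightarrow> \<tau> \<le> (\<sigma> n)\<^sup>2"
proof -
  define w where "w = sym_outer (q i) (q i)"
  define J where "J = {n \<in> I. \<tau> \<le> (\<sigma> n)\<^sup>2}"
  have \<sigma>0: "0 \<le> \<sigma> n" if "n \<in> I" for n
    using svd that unfolding is_svd_def Let_def I by blast
  have dec: "\<sigma> m \<le> \<sigma> n" if "n \<in> I" "m \<in> I" "n \<le> m" for n m
    using svd that unfolding is_svd_def Let_def I by blast
  have "J \<noteq> {}"
  proof
    assume "J = {}"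
    then have "u n \<bullet> w = 0" if "n \<in> I" for n
      using gram_sym_outer_coefficient[OF that, of i i] that i unfolding J_def w_def by force
    then have "(2 * (l i + l i)) *\<^sub>R w = 0"
      using gram_sym_outer[of i i] unfolding w_def by (simp add: sum.neutral)
    then have "w = 0" using i \<tau> by simp
    \<comment> \<open>The trace of \<open>w\<close>, taken against the identity, shows that \<open>w\<close> is nonzero.\<close>
    moreover have "mat 1 \<bullet> w = 2"
    proof -
      have "(mat 1 :: real^'d^'d) \<in> sym_mats" by (simp add: sym_mats_def)
      from inner_sym_outer[OF this, of "q i" "q i"] show ?thesis
        using eb by (simp add: w_def eigenbasis_def orthonormal_family_def)
    qed
    ultimately show False by simp
  qed
  moreover have "finite J" by (simp add: J_def I)
  ultimately have max: "Max J \<in> J" "\<And>n. n \<in> J \<Longrightarrow> n \<le> Max J" by auto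
  show ?thesis
  proof (rule that[of "Max J"])
    show "Max J \<in> I" using max(1) by (simp add: J_def)
    fix n assume n: "n \<in> I"
    show "n \<le> Max J \<longleftrightarrow> \<tau> \<le> (\<sigma> n)\<^sup>2"
    proof
      assume "n \<le> Max J"
      then have "\<sigma> (Max J) \<le> \<sigma> n" using dec n max(1) by (auto simp: J_def)
      then have "(\<sigma> (Max J))\<^sup>2 \<le> (\<sigma> n)\<^sup>2" using \<sigma>0 max(1) by (intro power_mono) (auto simp: J_def)
      then show "\<tau> \<le> (\<sigma> n)\<^sup>2" using max(1) by (simp add: J_def)
    next
      assume "\<tau> \<le> (\<sigma> n)\<^sup>2" then show "n \<le> Max J" using max(2) n by (simp add: J_def)
    qed
  qed
qed

end

section \<open>Perturbation of a low-rank semidefinite matrix\<close>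

lemma eigenbasis_norm_image:
  assumes eb: "eigenbasis Z q l"
  shows "(norm (Z *v x))\<^sup>2 = (\<Sum>i\<in>UNIV. (l i)\<^sup>2 * (q i \<bullet> x)\<^sup>2)"
proof -
  have "orthonormal_family q" using eb by (simp add: eigenbasis_def)
  then show ?thesis
    by (simp add: orthonormal_family_norm eigenbasis_coord[OF eb] power_mult_distrib)
qed

text \<open>
  In the eigenbasis this is \<open>m l \<le> l\<^sup>2\<close>, valid for \<open>l = 0\<close> and for \<open>l \<ge> m\<close>. It expresses the
  spectral gap of a low-rank semidefinite matrix without reference to its eigenvectors.
\<close>

lemma quadratic_form_le_norm_image:
  assumes eb: "eigenbasis Z q l" and gap: "\<And>i. l i = 0 \<or> m \<le> l i" and "0 < m"
  shows "m * (x \<bullet> (Z *v x)) \<le> (norm (Z *v x))\<^sup>2"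
  unfolding eigenbasis_norm_image[OF eb] eigenbasis_quadratic_form[OF eb] sum_distrib_left
proof (rule sum_mono)
  fix i
  have "m * l i \<le> (l i)\<^sup>2" using gap[of i] \<open>0 < m\<close> by (auto simp: power2_eq_square)
  then show "m * (l i * (q i \<bullet> x)\<^sup>2) \<le> (l i)\<^sup>2 * (q i \<bullet> x)\<^sup>2"
    by (metis mult.assoc mult_right_mono zero_le_power2)
qed

lemma quadratic_form_ge_on_range:
  assumes eb: "eigenbasis Z q l" and gap: "\<And>i. l i = 0 \<or> m \<le> l i" and "0 < m"
    and x: "x \<in> range ((*v) Z)"
  shows "m * (norm x)\<^sup>2 \<le> x \<bullet> (Z *v x)"
proof -
  obtain y where y: "x = Z *v y" using x by auto
  have "orthonormal_family q" using eb by (simp add: eigenbasis_def)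
  note nx = orthonormal_family_norm[OF this]
  show ?thesis
    unfolding nx eigenbasis_quadratic_form[OF eb] sum_distrib_left
  proof (rule sum_mono)
    fix i
    have "q i \<bullet> x = 0 \<or> m \<le> l i" using gap[of i] by (auto simp: y eigenbasis_coord[OF eb])
    then show "m * (q i \<bullet> x)\<^sup>2 \<le> l i * (q i \<bullet> x)\<^sup>2" by (auto intro: mult_right_mono)
  qed
qed

lemma quadratic_form_low_eigenspace:
  fixes Z Zs :: "real^'d^'d"
  assumes eb: "eigenbasis Z q l" and x: "\<And>i. i \<notin> L \<Longrightarrow> q i \<bullet> x = 0"
    and L: "\<And>i. i \<in> L \<Longrightarrow> l i \<le> c"
  shows "x \<bullet> (Zs *v x) \<le> (c + norm (Z - Zs)) * (norm x)\<^sup>2"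
proof -
  have on: "orthonormal_family q" using eb by (simp add: eigenbasis_def)
  have "x \<bullet> (Z *v x) \<le> c * (norm x)\<^sup>2"
    unfolding orthonormal_family_norm[OF on] eigenbasis_quadratic_form[OF eb] sum_distrib_left
  proof (rule sum_mono)
    fix i show "l i * (q i \<bullet> x)\<^sup>2 \<le> c * (q i \<bullet> x)\<^sup>2"
      using x[of i] L[of i] by (cases "i \<in> L") (auto intro: mult_right_mono)
  qed
  moreover have "\<bar>x \<bullet> ((Z - Zs) *v x)\<bar> \<le> norm x * (norm (Z - Zs) * norm x)"
    by (intro order_trans[OF Cauchy_Schwarz_ineq2] mult_left_mono norm_matrix_vector_mult) auto
  ultimately show ?thesis
    by (simp add: matrix_vector_mult_diff_rdistrib inner_diff_right power2_eq_square algebra_simps)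
qed

text \<open>
  The one-sided Weyl inequality that is needed here, by counting dimensions. If too many eigenvalues of
  \<open>Z\<close> lay below \<open>c\<close>, their eigenspace would meet the range of \<open>Zs\<close>; a common vector would have a
  Rayleigh quotient for \<open>Zs\<close> of at least \<open>m\<close> and of at most \<open>c + norm (Z - Zs)\<close>.
\<close>

lemma card_high_eigenvalues_ge_rank:
  fixes Z Zs :: "real^'d^'d"
  assumes eb: "eigenbasis Z q l" and ebs: "eigenbasis Zs p e"
    and gap: "\<And>i. e i = 0 \<or> m \<le> e i" and "0 < m"
    and c: "c + norm (Z - Zs) < m"
  shows "rank Zs \<le> card {i. c \<le> l i}"
proof (rule ccontr)
  assume "\<not> rank Zs \<le> card {i. c \<le> l i}"
  then have less: "card {i. c \<le> l i} < rank Zs" by simp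
  have on: "orthonormal_family q" using eb by (simp add: eigenbasis_def)
  define L where "L = {i. l i < c}"
  define V where "V = span (q ` L)"
  define W where "W = range ((*v) Zs)"
  have sW: "subspace W" unfolding W_def
    by (intro linear_subspace_image matrix_vector_mul_linear subspace_UNIV)
  have dV: "dim V = card L" unfolding V_def by (rule dim_span_orthonormal_family[OF on])
  have dW: "dim W = rank Zs" by (simp only: W_def rank_dim_range)
  have "card L + card {i. c \<le> l i} = card (L \<union> {i. c \<le> l i})"
    by (subst card_Un_disjoint) (auto simp: L_def)
  also have "L \<union> {i. c \<le> l i} = UNIV" by (auto simp: L_def)
  finally have "CARD('d) < dim V + dim W" using less by (simp add: dV dW)
  moreover have "dim {x + y |x y. x \<in> V \<and> y \<in> W} \<le> CARD('d)" by (rule dim_subset_UNIV_cart)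
  moreover have "dim {x + y |x y. x \<in> V \<and> y \<in> W} + dim (V \<inter> W) = dim V + dim W"
    by (rule dim_sums_Int) (simp_all add: V_def sW)
  ultimately have "dim (V \<inter> W) \<noteq> 0" by linarith
  then obtain x where x: "x \<in> V" "x \<in> W" "x \<noteq> 0" by (auto simp: dim_eq_0)
  have ortho: "q i \<bullet> x = 0" if "i \<notin> L" for i
  proof -
    have "orthogonal (q i) x"
    proof (rule orthogonal_to_span)
      show "x \<in> span (q ` L)" using x(1) by (simp add: V_def)
      show "orthogonal (q i) y" if "y \<in> q ` L" for y
        using that \<open>i \<notin> L\<close> on by (auto simp: orthonormal_family_def orthogonal_def)
    qed
    then show ?thesis by (simp add: orthogonal_def)
  qed
  have "m * (norm x)\<^sup>2 \<le> x \<bullet> (Zs *v x)"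
    using x(2) by (intro quadratic_form_ge_on_range[OF ebs gap \<open>0 < m\<close>]) (simp add: W_def)
  also have "\<dots> \<le> (c + norm (Z - Zs)) * (norm x)\<^sup>2"
    by (rule quadratic_form_low_eigenspace[OF eb, where L = L]) (use ortho in \<open>auto simp: L_def\<close>)
  finally have "m \<le> c + norm (Z - Zs)" using x(3) by (simp add: mult_le_cancel_right_pos)
  with c show False by simp
qed

text \<open>
  The block of \<open>Zs\<close> on the low eigenspace of \<open>Z\<close> is of second order in the perturbation. Let \<open>t\<close>
  be its trace, \<open>N\<close> its squared Frobenius norm and \<open>\<epsilon>\<close> the norm of the perturbation. Since
  \<open>Zs\<^sup>2 \<ge> m Zs\<close>, taking the trace over the block gives
  \<open>m t \<le> N + (squared norm of the off-diagonal block)\<close>.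
  As \<open>Z\<close> is diagonal in its eigenbasis, the off-diagonal blocks of \<open>Zs\<close> are, up to sign, those of
  the perturbation; there are two of them, so each has squared norm at most \<open>\<epsilon>\<^sup>2 / 2\<close>.

  It remains to absorb \<open>N\<close>. The operator norm of the block is at most \<open>c + \<epsilon> \<le> 2 m / 3\<close>, so
  \<open>N \<le> 2 m t / 3\<close>, which yields the crude estimate \<open>t \<le> m / 6\<close>. With it, \<open>N \<le> t\<^sup>2 \<le> m t / 6\<close>, and
  the inequality gives \<open>m t \<le> \<epsilon>\<^sup>2\<close>.
\<close>

lemma low_block_bound:
  fixes Z Zs :: "real^'d^'d"
  assumes eb: "eigenbasis Z q l" and psd: "psd Zs" and ebs: "eigenbasis Zs p e"
    and gap: "\<And>i. e i = 0 \<or> m \<le> e i" and m: "0 < m"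
    and c: "c + norm (Z - Zs) \<le> 2/3 * m" and small: "norm (Z - Zs) \<le> m / 3"
  defines "L \<equiv> {i. l i < c}"
  shows "m\<^sup>2 * (\<Sum>i\<in>L. \<Sum>k\<in>L. (q i \<bullet> (Zs *v q k))\<^sup>2) \<le> norm (Z - Zs) ^ 4"
proof -
  have on: "orthonormal_family q" and ev: "\<And>i. Z *v q i = l i *\<^sub>R q i"
    using eb by (auto simp: eigenbasis_def)
  note sym = sym_mats_inner[OF psdD(1)[OF psd]]
  define a where "a i k = q i \<bullet> (Zs *v q k)" for i k
  define eps where "eps = norm (Z - Zs)"
  define t where "t = (\<Sum>i\<in>L. a i i)"
  define N where "N = (\<Sum>i\<in>L. \<Sum>k\<in>L. (a i k)\<^sup>2)"
  have asym: "a i k = a k i" for i k unfolding a_def using sym[of "q i" "q k"] by (simp add: inner_commute)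
  have CS: "(x \<bullet> (Zs *v y))\<^sup>2 \<le> (x \<bullet> (Zs *v x)) * (y \<bullet> (Zs *v y))" for x y
    by (rule semidefinite_form_Cauchy_Schwarz[OF matrix_vector_mul_linear sym subspace_UNIV])
       (auto intro: psdD(2)[OF psd])
  have a0: "0 \<le> a i i" for i unfolding a_def by (rule psdD(2)[OF psd])
  have t0: "0 \<le> t" unfolding t_def by (intro sum_nonneg a0)
  \<comment> \<open>A semidefinite \<open>M\<close> with \<open>M \<le> \<beta> I\<close> has \<open>M\<^sup>2 \<le> \<beta> M\<close>: Cauchy-Schwarz for the form of \<open>M\<close>
    between \<open>q i\<close> and \<open>y\<close>, the image of \<open>q i\<close> under the compressed matrix.\<close>
  have N1: "(\<Sum>k\<in>L. (a i k)\<^sup>2) \<le> 2/3 * m * a i i" for i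
  proof -
    define n where "n = (\<Sum>k\<in>L. (a i k)\<^sup>2)"
    define y where "y = (\<Sum>k\<in>L. a i k *\<^sub>R q k)"
    have qy: "q k \<bullet> y = (if k \<in> L then a i k else 0)" for k
    proof -
      have "q k \<bullet> y = (\<Sum>j\<in>L. if j = k then a i j else 0)"
        unfolding y_def inner_sum_right using on
        by (intro sum.cong) (auto simp: orthonormal_family_def)
      then show ?thesis by simp
    qed
    have "(norm y)\<^sup>2 = (\<Sum>k\<in>UNIV. if k \<in> L then (a i k)\<^sup>2 else 0)"
      unfolding orthonormal_family_norm[OF on] by (intro sum.cong) (auto simp: qy)
    then have ny: "(norm y)\<^sup>2 = n" by (simp add: n_def sum.inter_restrict[symmetric])
    have "q i \<bullet> (Zs *v y) = n"
      unfolding y_def n_def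
      by (simp add: linear_sum[OF matrix_vector_mul_linear] linear_scale[OF matrix_vector_mul_linear]
          inner_sum_right a_def power2_eq_square)
    with CS[of "q i" y] have "n\<^sup>2 \<le> a i i * (y \<bullet> (Zs *v y))" by (simp add: a_def)
    also have "\<dots> \<le> a i i * ((c + norm (Z - Zs)) * (norm y)\<^sup>2)"
      by (intro mult_left_mono a0 quadratic_form_low_eigenspace[OF eb, of L])
         (auto simp: qy L_def)
    also have "\<dots> \<le> a i i * (2/3 * m * (norm y)\<^sup>2)"
      using c by (intro mult_left_mono mult_right_mono a0) auto
    finally have n2: "n * n \<le> (2/3 * m * a i i) * n"
      unfolding ny by (simp add: power2_eq_square mult_ac)
    have "0 \<le> n" unfolding n_def by (intro sum_nonneg) auto
    show ?thesis
    proof (cases "n = 0")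
      case True
      then show ?thesis using m a0[of i] by (simp add: n_def)
    next
      case False
      with \<open>0 \<le> n\<close> have "0 < n" by simp
      with n2 show ?thesis unfolding n_def[symmetric] by (simp only: mult_le_cancel_right_pos)
    qed
  qed
  have N2: "N \<le> t\<^sup>2"
  proof -
    have "N \<le> (\<Sum>i\<in>L. \<Sum>k\<in>L. a i i * a k k)"
      unfolding N_def by (intro sum_mono) (auto simp: a_def intro: CS)
    also have "\<dots> = t\<^sup>2" by (simp add: t_def power2_eq_square sum_product)
    finally show ?thesis .
  qed
  have off: "2 * (\<Sum>i\<in>L. \<Sum>k\<in>-L. (a i k)\<^sup>2) \<le> eps\<^sup>2"
  proof -
    define b where "b i k = (q i \<bullet> ((Z - Zs) *v q k))\<^sup>2" for i k
    have ba: "b i k = (a i k)\<^sup>2" if "i \<noteq> k" for i k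
      using on that unfolding b_def a_def
      by (auto simp: matrix_vector_mult_diff_rdistrib inner_diff_right ev orthonormal_family_def)
    have b0: "0 \<le> b i k" for i k by (simp add: b_def)
    have split: "sum g UNIV = sum g L + sum g (-L)" for g :: "'d \<Rightarrow> real"
      by (metis Compl_eq_Diff_UNIV add.commute finite sum.subset_diff top_greatest)
    have "eps\<^sup>2 = (\<Sum>k\<in>UNIV. \<Sum>i\<in>UNIV. b i k)"
      by (simp add: eps_def norm_matrix_orthonormal[OF on] b_def)
    also have "\<dots> = (\<Sum>k\<in>L. \<Sum>i\<in>L. b i k) + (\<Sum>k\<in>L. \<Sum>i\<in>-L. b i k)
        + ((\<Sum>k\<in>-L. \<Sum>i\<in>L. b i k) + (\<Sum>k\<in>-L. \<Sum>i\<in>-L. b i k))"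
      by (simp only: split sum.distrib)
    also have "(\<Sum>k\<in>L. \<Sum>i\<in>-L. b i k) = (\<Sum>i\<in>L. \<Sum>k\<in>-L. (a i k)\<^sup>2)"
      by (intro sum.cong refl) (metis ba ComplD asym)
    also have "(\<Sum>k\<in>-L. \<Sum>i\<in>L. b i k) = (\<Sum>i\<in>L. \<Sum>k\<in>-L. (a i k)\<^sup>2)"
      by (subst sum.swap, intro sum.cong refl) (metis ba ComplD)
    finally show ?thesis
      using sum_nonneg[of L "\<lambda>k. \<Sum>i\<in>L. b i k"] sum_nonneg[of "-L" "\<lambda>k. \<Sum>i\<in>-L. b i k"]
      by (simp add: b0 sum_nonneg)
  qed
  have "m * t \<le> (\<Sum>i\<in>L. \<Sum>k\<in>UNIV. (a i k)\<^sup>2)"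
    unfolding t_def sum_distrib_left
  proof (rule sum_mono)
    fix i
    have "(norm (Zs *v q i))\<^sup>2 = (\<Sum>k\<in>UNIV. (a i k)\<^sup>2)"
      unfolding orthonormal_family_norm[OF on] by (intro sum.cong refl) (metis a_def asym)
    then show "m * a i i \<le> (\<Sum>k\<in>UNIV. (a i k)\<^sup>2)"
      using quadratic_form_le_norm_image[OF ebs gap m, of "q i"] by (simp add: a_def)
  qed
  also have "\<dots> = N + (\<Sum>i\<in>L. \<Sum>k\<in>-L. (a i k)\<^sup>2)"
    unfolding N_def sum.distrib[symmetric]
    by (intro sum.cong refl) (metis Compl_eq_Diff_UNIV add.commute finite sum.subset_diff top_greatest)
  finally have main: "m * t \<le> N + eps\<^sup>2 / 2" using off by simp
  have "N \<le> 2/3 * m * t"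
    unfolding N_def t_def sum_distrib_left by (intro sum_mono N1)
  \<comment> \<open>First round of the bootstrap, with the operator norm bound.\<close>
  with main have "m * t \<le> 3/2 * eps\<^sup>2" by simp
  moreover have "eps\<^sup>2 \<le> (m/3)\<^sup>2" using small by (intro power_mono) (auto simp: eps_def)
  ultimately have "m * t \<le> m * (m / 6)" by (simp add: power2_eq_square)
  then have "t \<le> m / 6" using m by (simp only: mult_le_cancel_left_pos)
  \<comment> \<open>Second round, with the bound just obtained for the trace.\<close>
  then have "t\<^sup>2 \<le> m / 6 * t" unfolding power2_eq_square using t0 by (rule mult_right_mono)
  moreover have "0 \<le> m * t" using t0 m by simp
  ultimately have "m * t \<le> eps\<^sup>2" using main N2 by simp
  then have "(m * t)\<^sup>2 \<le> (eps\<^sup>2)\<^sup>2" using m t0 by (intro power_mono) auto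
  moreover have "m\<^sup>2 * N \<le> m\<^sup>2 * t\<^sup>2" using N2 by (intro mult_left_mono) auto
  ultimately show ?thesis
    by (simp add: N_def a_def eps_def power_mult_distrib)
qed

text \<open>
  Only entries with both indices low survive in the residual. On the diagonal \<open>l i\<close> and the entry of
  \<open>Zs\<close> are both nonnegative, so the square of their difference is at most the sum of their squares;
  off the diagonal \<open>Z\<close> contributes nothing. The diagonal condition \<open>4 l i < \<tau>\<close> produces \<open>\<tau> / 4\<close>.
\<close>

lemma residual_norm_bound:
  fixes Z Zs R :: "real^'d^'d"
  assumes eb: "eigenbasis Z q l" and l0: "\<And>i. 0 \<le> l i"
    and R: "\<And>i k. (q i \<bullet> (R *v q k))\<^sup>2
        \<le> (if 2 * (l i + l k) < \<tau> then (q i \<bullet> ((Z - Zs) *v q k))\<^sup>2 else 0)"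
    and psd: "psd Zs"
  defines "L \<equiv> {i. l i < \<tau> / 2}"
  shows "(norm R)\<^sup>2 \<le> real (card {i\<in>L. l i \<noteq> 0}) * (\<tau> / 4)\<^sup>2
     + (\<Sum>i\<in>L. \<Sum>k\<in>L. (q i \<bullet> (Zs *v q k))\<^sup>2)"
proof -
  have on: "orthonormal_family q" and ev: "\<And>i. Z *v q i = l i *\<^sub>R q i"
    using eb by (auto simp: eigenbasis_def)
  have qq: "q i \<bullet> q k = (if i = k then 1 else 0)" for i k
    using on by (simp add: orthonormal_family_def)
  define a where "a i k = q i \<bullet> (Zs *v q k)" for i k
  have a0: "0 \<le> a i i" for i unfolding a_def by (rule psdD(2)[OF psd])
  define g where "g i = (if l i = 0 then 0 else (\<tau> / 4)\<^sup>2)" for i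
  have entry: "(q i \<bullet> (R *v q k))\<^sup>2 \<le> (if i = k then g i else 0) + (a i k)\<^sup>2"
    (is "?r \<le> _") for i k
  proof (cases "2 * (l i + l k) < \<tau>")
    case False
    have "?r \<le> 0" using R[of i k] False by simp
    also have "0 \<le> (if i = k then g i else 0) + (a i k)\<^sup>2" by (simp add: g_def)
    finally show ?thesis .
  next
    case True
    then have r: "?r \<le> ((if i = k then l i else 0) - a i k)\<^sup>2"
      using R[of i k]
      by (simp add: matrix_vector_mult_diff_rdistrib inner_diff_right ev qq a_def if_distrib cong: if_cong)
    show ?thesis
    proof (cases "i = k")
      case False then show ?thesis using r by simp
    next
      case eq: True
      have "(l i)\<^sup>2 \<le> (\<tau> / 4)\<^sup>2" using True eq l0[of i] by (intro power_mono) auto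
      then have "(l i)\<^sup>2 \<le> g i" by (auto simp: g_def)
      moreover have "(l i - a i i)\<^sup>2 \<le> (l i)\<^sup>2 + (a i i)\<^sup>2"
        using mult_nonneg_nonneg[OF l0[of i] a0[of i]] by (simp add: power2_diff)
      ultimately show ?thesis using r eq by simp
    qed
  qed
  have zero: "(q i \<bullet> (R *v q k))\<^sup>2 = 0" if "i \<notin> L \<or> k \<notin> L" for i k
  proof -
    have "\<not> 2 * (l i + l k) < \<tau>" using that l0[of i] l0[of k] by (auto simp: L_def)
    then have "(q i \<bullet> (R *v q k))\<^sup>2 \<le> 0" using R[of i k] by simp
    then show ?thesis by simp
  qed
  have "(norm R)\<^sup>2 = (\<Sum>k\<in>UNIV. \<Sum>i\<in>UNIV. (q i \<bullet> (R *v q k))\<^sup>2)"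
    by (rule norm_matrix_orthonormal[OF on])
  also have "\<dots> = (\<Sum>i\<in>UNIV. \<Sum>k\<in>UNIV. (q i \<bullet> (R *v q k))\<^sup>2)" by (rule sum.swap)
  also have "\<dots> = (\<Sum>i\<in>L. \<Sum>k\<in>UNIV. (q i \<bullet> (R *v q k))\<^sup>2)"
    by (rule sum.mono_neutral_right) (auto simp: zero intro!: sum.neutral)
  also have "\<dots> = (\<Sum>i\<in>L. \<Sum>k\<in>L. (q i \<bullet> (R *v q k))\<^sup>2)"
    by (intro sum.cong refl sum.mono_neutral_right) (auto simp: zero)
  also have "\<dots> \<le> (\<Sum>i\<in>L. \<Sum>k\<in>L. (if i = k then g i else 0) + (a i k)\<^sup>2)"
    by (intro sum_mono entry)
  also have "\<dots> = (\<Sum>i\<in>L. g i) + (\<Sum>i\<in>L. \<Sum>k\<in>L. (a i k)\<^sup>2)"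
    by (simp add: sum.distrib)
  also have "(\<Sum>i\<in>L. g i) = (\<Sum>i\<in>{i\<in>L. l i \<noteq> 0}. g i)"
    by (rule sum.mono_neutral_right) (auto simp: g_def)
  also have "\<dots> = real (card {i\<in>L. l i \<noteq> 0}) * (\<tau> / 4)\<^sup>2" by (simp add: g_def)
  finally show ?thesis by (simp add: a_def)
qed

section \<open>Weak alignment\<close>

lemma orth_proj_0: "subspace S \<Longrightarrow> orth_proj S 0 = 0"
  using orth_proj_props[of S 0] by (auto simp: orthogonal_def)

lemma svd_deriv_F_sym_index_one:
  fixes X :: "real^'r^'d"
  assumes svd: "is_svd sym_mats (deriv_at F_sym X) \<sigma> u v" and "F_sym X \<noteq> 0"
  shows "1 \<in> {1..min DIM(real^'r^'d) (dim (sym_mats :: (real^'d^'d) set))}" (is "_ \<in> ?I")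
proof -
  have "deriv_at F_sym X X = 2 *\<^sub>R F_sym X" by (simp add: deriv_at_F_sym F_sym_def scaleR_2)
  then have "deriv_at F_sym X X \<noteq> 0" using assms(2) by simp
  moreover have "deriv_at F_sym X X = (\<Sum>i\<in>?I. (\<sigma> i * (v i \<bullet> X)) *\<^sub>R u i)"
    using svd unfolding is_svd_def Let_def by blast
  ultimately have "?I \<noteq> {}" by force
  then show ?thesis by auto
qed

text \<open>
  The residual bound is split evenly: the factor \<open>1 / sqrt 2\<close> in the radius and the one in \<open>s\<close> each
  leave half of \<open>(\<rho> \<epsilon>)\<^sup>2\<close>, to the block of \<open>Zs\<close> and to the eigenvalues of \<open>Z\<close> respectively.
\<close>

lemma weak_alignment_index:
  fixes X :: "real^'r^'d" and Zs :: "real^'d^'d"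
  assumes svd: "is_svd sym_mats (deriv_at F_sym X) \<sigma> u v"
    and psd: "psd Zs" and ebs: "eigenbasis Zs p e"
    and gap: "\<And>i. e i = 0 \<or> m \<le> e i" and m: "0 < m"
    and rank1: "1 \<le> rank Zs" and rank: "rank Zs \<le> CARD('r)"
    and \<rho>: "0 < \<rho>" and s: "s = 4 * \<rho> / sqrt (2 * (real CARD('r) - real (rank Zs) + 1))"
    and close: "norm (F_sym X - Zs) \<le> min (\<rho> / sqrt 2) (min (1 / (1 + s)) (1 / 3)) * m"
  shows "\<exists>j\<in>{1..min DIM(real^'r^'d) (dim (sym_mats :: (real^'d^'d) set))}.
     norm ((F_sym X - Zs) - orth_proj (span (u ` {1..j})) (F_sym X - Zs)) \<le> \<rho> * norm (F_sym X - Zs)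
     \<and> s * norm (F_sym X - Zs) \<le> (\<sigma> j)\<^sup>2"
proof (cases "F_sym X = Zs")
  case True
  have "Zs \<noteq> 0" using rank1 by auto
  with True show ?thesis using svd_deriv_F_sym_index_one[OF svd]
    by (intro bexI[of _ 1]) (auto simp: orth_proj_0)
next
  case False
  let ?I = "{1..min DIM(real^'r^'d) (dim (sym_mats :: (real^'d^'d) set))}"
  define Z where "Z = F_sym X"
  define eps where "eps = norm (Z - Zs)"
  define \<tau> where "\<tau> = s * eps"
  define K where "K = real CARD('r) - real (rank Zs)"
  have K0: "0 \<le> K" using rank by (simp add: K_def)
  have s0: "0 < s" using \<rho> K0 by (simp add: s K_def[symmetric])
  have eps0: "0 < eps" using False by (simp add: eps_def Z_def)
  have \<tau>0: "0 < \<tau>" using s0 eps0 by (simp add: \<tau>_def)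
  have le: "eps \<le> x * m" if "min (\<rho> / sqrt 2) (min (1 / (1 + s)) (1 / 3)) \<le> x" for x
    using close mult_right_mono[OF that, of m] m unfolding eps_def Z_def by linarith
  have e1: "eps \<le> \<rho> / sqrt 2 * m" by (rule le) simp
  have "eps \<le> 1 / (1 + s) * m" by (rule le) simp
  then have "eps * (1 + s) \<le> m" using s0 by (simp add: field_simps)
  \<comment> \<open>Half of this and half of \<open>e3\<close> add up to the \<open>2/3\<close> in \<open>c\<close>.\<close>
  then have e2: "eps + \<tau> \<le> m" by (simp add: \<tau>_def algebra_simps)
  have "eps \<le> 1 / 3 * m" by (rule le) linarith
  then have e3: "eps \<le> m / 3" by simp
  have c: "\<tau> / 2 + eps \<le> 2/3 * m" using e2 e3 by simp
  obtain q l where eb: "eigenbasis Z q l"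
    using sym_mats_eigenbasis[OF F_sym_in_sym_mats[of X]] unfolding Z_def by blast
  have psdZ: "psd Z" unfolding Z_def by (rule psd_F_sym)
  have l0: "0 \<le> l i" for i by (rule psd_eigenvalue_nonneg[OF psdZ eb])
  define L where "L = {i. l i < \<tau> / 2}"
  have high: "rank Zs \<le> card {i. \<tau> / 2 \<le> l i}"
    using c m unfolding eps_def by (intro card_high_eigenvalues_ge_rank[OF eb ebs gap m]) auto
  then have "card {i. \<tau> / 2 \<le> l i} \<noteq> 0" using rank1 by linarith
  then obtain i where i: "\<tau> / 2 \<le> l i" by (metis (mono_tags, lifting) card.empty empty_Collect_eq)
  then have "\<tau> \<le> 4 * l i" using \<tau>0 by simp
  then obtain j where j: "j \<in> ?I" and top: "\<And>n. n \<in> ?I \<Longrightarrow> n \<le> j \<longleftrightarrow> \<tau> \<le> (\<sigma> n)\<^sup>2"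
    using threshold_index[OF svd refl eb[unfolded Z_def] \<tau>0] by blast
  define R where "R = (Z - Zs) - orth_proj (span (u ` {1..j})) (Z - Zs)"
  have "Z - Zs \<in> sym_mats"
    using psdD(1)[OF psdZ] psdD(1)[OF psd] by (rule subspace_diff[OF subspace_sym_mats])
  note res = residual_entry[OF svd refl eb[unfolded Z_def] j top \<tau>0 this]
  have low: "(norm R)\<^sup>2 \<le> real (card {i\<in>L. l i \<noteq> 0}) * (\<tau> / 4)\<^sup>2
     + (\<Sum>i\<in>L. \<Sum>k\<in>L. (q i \<bullet> (Zs *v q k))\<^sup>2)"
    unfolding L_def R_def by (rule residual_norm_bound[OF eb l0 res psd])
  \<comment> \<open>At most \<open>r\<close> eigenvalues of \<open>X X\<^sup>T\<close> are nonzero, and at least \<open>rank Zs\<close> of these are high.\<close>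
  have "real (card {i\<in>L. l i \<noteq> 0}) \<le> K"
  proof -
    have "{i. l i \<noteq> 0} = {i\<in>L. l i \<noteq> 0} \<union> {i. \<tau> / 2 \<le> l i}" using \<tau>0 by (auto simp: L_def)
    then have "card {i. l i \<noteq> 0} = card ({i\<in>L. l i \<noteq> 0} \<union> {i. \<tau> / 2 \<le> l i})" by simp
    also have "\<dots> = card {i\<in>L. l i \<noteq> 0} + card {i. \<tau> / 2 \<le> l i}"
      by (rule card_Un_disjoint) (auto simp: L_def)
    finally show ?thesis
      using high rank_F_sym[of X] rank_eigenbasis[OF eb] unfolding K_def Z_def by linarith
  qed
  then have "real (card {i\<in>L. l i \<noteq> 0}) * (\<tau> / 4)\<^sup>2 \<le> K * (\<tau> / 4)\<^sup>2"
    by (intro mult_right_mono) auto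
  also have "\<dots> \<le> (K + 1) * (\<tau> / 4)\<^sup>2" by (intro mult_right_mono) auto
  also have "\<dots> = (\<rho> * eps)\<^sup>2 / 2"
    using K0 by (simp add: \<tau>_def s K_def[symmetric] power_mult_distrib power_divide field_simps)
  finally have part1: "real (card {i\<in>L. l i \<noteq> 0}) * (\<tau> / 4)\<^sup>2 \<le> (\<rho> * eps)\<^sup>2 / 2" .
  have "m\<^sup>2 * (\<Sum>i\<in>L. \<Sum>k\<in>L. (q i \<bullet> (Zs *v q k))\<^sup>2) \<le> eps ^ 4"
    unfolding L_def eps_def
    by (rule low_block_bound[OF eb psd ebs gap m]) (use c e3 in \<open>simp_all add: eps_def\<close>)
  also have "eps ^ 4 = eps\<^sup>2 * eps\<^sup>2" by simp
  also have "\<dots> \<le> (\<rho> / sqrt 2 * m)\<^sup>2 * eps\<^sup>2"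
    using e1 eps0 by (intro mult_right_mono power_mono) auto
  also have "\<dots> = m\<^sup>2 * ((\<rho> * eps)\<^sup>2 / 2)" by (simp add: power_mult_distrib power_divide)
  finally have part2: "(\<Sum>i\<in>L. \<Sum>k\<in>L. (q i \<bullet> (Zs *v q k))\<^sup>2) \<le> (\<rho> * eps)\<^sup>2 / 2"
    using m by (simp only: mult_le_cancel_left_pos zero_less_power)
  have "(norm R)\<^sup>2 \<le> (\<rho> * eps)\<^sup>2" using low part1 part2 by linarith
  moreover have "0 \<le> \<rho> * eps" using \<rho> eps0 by simp
  ultimately have "norm R \<le> \<rho> * eps" by (rule power2_le_imp_le)
  moreover have "\<tau> \<le> (\<sigma> j)\<^sup>2" using top[OF j] order.refl by (rule iffD1)
  ultimately show ?thesis
    using j unfolding R_def eps_def \<tau>_def Z_def by blast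
qed

lemma weakly_aligned_F_sym:
  fixes \<sigma> :: "real^'r^'d \<Rightarrow> nat \<Rightarrow> real" and u :: "real^'r^'d \<Rightarrow> nat \<Rightarrow> real^'d^'d"
    and Zs :: "real^'d^'d"
  assumes svd: "\<And>X. is_svd sym_mats (deriv_at F_sym X) (\<sigma> X) (u X) (v X)"
    and psd: "psd Zs" and rank1: "1 \<le> rank Zs" and rank: "rank Zs \<le> CARD('r)"
  defines "s \<equiv> \<lambda>\<rho>. 4 * \<rho> / sqrt (2 * (real CARD('r) - real (rank Zs) + 1))"
  shows "weakly_aligned sym_mats F_sym \<sigma> u Zs
    (\<lambda>\<rho>. min (\<rho> / sqrt 2) (min (1 / (1 + s \<rho>)) (1 / 3)) * nth_eigenvalue Zs (rank Zs)) s"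
proof -
  obtain p e where eb: "eigenbasis Zs p e" using sym_mats_eigenbasis[OF psdD(1)[OF psd]] .
  have e0: "0 \<le> e i" for i by (rule psd_eigenvalue_nonneg[OF psd eb])
  then have "{i. 0 < e i} = {i. e i \<noteq> 0}" by (auto simp: less_le)
  then have card: "card {i. 0 < e i} = rank Zs" by (simp add: rank_eigenbasis[OF eb])
  define m where "m = nth_eigenvalue Zs (rank Zs)"
  have m: "0 < m" and gap: "e i = 0 \<or> m \<le> e i" for i
    using nth_eigenvalue_least_positive[OF eb card rank1] e0[of i] unfolding m_def
    by (auto simp: less_le)
  have s0: "0 < s \<rho>" if "0 < \<rho>" for \<rho>
    using that rank by (simp add: s_def)
  have index: "\<exists>j\<in>{1..min DIM(real^'r^'d) (dim (sym_mats :: (real^'d^'d) set))}.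
     norm ((F_sym X - Zs) - orth_proj (span (u X ` {1..j})) (F_sym X - Zs)) \<le> \<rho> * norm (F_sym X - Zs)
     \<and> s \<rho> * norm (F_sym X - Zs) \<le> (\<sigma> X j)\<^sup>2"
    if "0 < \<rho>" "F_sym X \<in> cball Zs (min (\<rho> / sqrt 2) (min (1 / (1 + s \<rho>)) (1 / 3)) * m)"
    for \<rho> X
    using that(2) by (intro weak_alignment_index[OF svd psd eb gap m rank1 rank that(1)])
      (auto simp: s_def dist_norm norm_minus_commute)
  show ?thesis
    unfolding weakly_aligned_def m_def[symmetric]
    using psd_in_range_F_sym[OF psd rank] s0 m index by (auto simp: add_pos_pos)
qed

theorem theorem5p5:
  shows "(\<forall>X Y :: real^'r^'d.
            onorm (\<lambda>H. deriv_at F_sym X H - deriv_at F_sym Y H) \<le> 2 * norm (X - Y)) \<and>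
         (\<forall>(\<sigma> :: real^'r^'d \<Rightarrow> nat \<Rightarrow> real) (u :: real^'r^'d \<Rightarrow> nat \<Rightarrow> real^'d^'d)
            (v :: real^'r^'d \<Rightarrow> nat \<Rightarrow> real^'r^'d) (Zstar :: real^'d^'d) (rstar :: nat).
            (\<forall>X. is_svd sym_mats (deriv_at F_sym X) (\<sigma> X) (u X) (v X)) \<longrightarrow>
            psd Zstar \<longrightarrow> rank Zstar = rstar \<longrightarrow> 1 \<le> rstar \<longrightarrow> rstar \<le> CARD('r) \<longrightarrow>
            (let s = (\<lambda>\<rho>. 4 * \<rho> / sqrt (2 * (real CARD('r) - real rstar + 1)));
                 \<delta> = (\<lambda>\<rho>. min (\<rho> / sqrt 2) (min (1 / (1 + s \<rho>)) (1 / 3))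
                           * nth_eigenvalue Zstar rstar)
             in weakly_aligned sym_mats F_sym \<sigma> u Zstar \<delta> s))"
proof (intro conjI allI impI)
  fix X Y :: "real^'r^'d"
  show "onorm (\<lambda>H. deriv_at F_sym X H - deriv_at F_sym Y H) \<le> 2 * norm (X - Y)"
    by (rule onorm_deriv_F_sym_diff)
next
  fix \<sigma> :: "real^'r^'d \<Rightarrow> nat \<Rightarrow> real" and u :: "real^'r^'d \<Rightarrow> nat \<Rightarrow> real^'d^'d"
    and v :: "real^'r^'d \<Rightarrow> nat \<Rightarrow> real^'r^'d" and Zstar :: "real^'d^'d" and rstar :: nat
  assume svd: "\<forall>X. is_svd sym_mats (deriv_at F_sym X) (\<sigma> X) (u X) (v X)"
    and psd: "psd Zstar" and rank: "rank Zstar = rstar" and r: "1 \<le> rstar" "rstar \<le> CARD('r)"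
  show "let s = (\<lambda>\<rho>. 4 * \<rho> / sqrt (2 * (real CARD('r) - real rstar + 1)));
            \<delta> = (\<lambda>\<rho>. min (\<rho> / sqrt 2) (min (1 / (1 + s \<rho>)) (1 / 3)) * nth_eigenvalue Zstar rstar)
        in weakly_aligned sym_mats F_sym \<sigma> u Zstar \<delta> s"
    using weakly_aligned_F_sym[OF svd[rule_format] psd r[folded rank]] by (simp only: Let_def rank)
qed

end
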